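(* Let $\mathcal{A}$ be a finite alphabet and let $X\subset\mathcal{A}^{\mathbb{Z}}$ be a subshift whose complexity function satisfies $\liminf_{n\to\infty}\frac{P_X(n)}{n^2}=0$. Then $\operatorname{Aut}(X)$ does not contain an isomorphic copy of the free semigroup on two generators.
   Context: $\mathcal{A}^{\mathbb{Z}}$ carries the product topology (with $\mathcal{A}$ discrete), and $\sigma:\mathcal{A}^{\mathbb{Z}}\to\mathcal{A}^{\mathbb{Z}}$ is the left shift, $(\sigma x)_i=x_{i+1}$. A subshift is a closed, $\sigma$-invariant set $X\subset\mathcal{A}^{\mathbb{Z}}$ (with $\sigma X=X$), together with $\sigma|_X$. A word $w=(w_0,\dots,w_{n-1})\in\mathcal{A}^n$ belongs to $\mathcal{L}_n(X)$ if there is $x\in X$ with $x_i=w_i$ for $0\le i<n$. The complexity function is $P_X(n)=|\mathcal{L}_n(X)|$. $\operatorname{Aut}(X)$ is the group, under composition, of all homeomorphisms $\phi:X\to X$ with $\phi\circ\sigma=\sigma\circ\phi$. A group $G$ contains an isomorphic copy of the free semigroup on two generators if there are $g_1,g_2\in G$ such that distinct finite words in the letters $g_1,g_2$ (no inverses) represent distinct elements of $G$. *)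

theory Defs
  imports "HOL-Analysis.Analysis" "HOL-Algebra.Bij"
begin

definition full_shift :: "'a set \<Rightarrow> (int \<Rightarrow> 'a) topology"
  where "full_shift A = product_topology (\<lambda>_. discrete_topology A) UNIV"

definition shift :: "(int \<Rightarrow> 'a) \<Rightarrow> (int \<Rightarrow> 'a)"
  where "shift x = (\<lambda>i. x (i + 1))"

definition subshift :: "'a set \<Rightarrow> (int \<Rightarrow> 'a) set \<Rightarrow> bool"
  where "subshift A X \<longleftrightarrow> closedin (full_shift A) X \<and> shift ` X = X"

definition language :: "(int \<Rightarrow> 'a) set \<Rightarrow> nat \<Rightarrow> 'a list set"
  where "language X n = {w. length w = n \<and> (\<exists>x\<in>X. \<forall>i<n. x (int i) = w ! i)}"

definition complexity :: "(int \<Rightarrow> 'a) set \<Rightarrow> nat \<Rightarrow> nat"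
  where "complexity X n = card (language X n)"

text \<open>As for \<^const>\<open>BijGroup\<close>, self-maps of \<open>X\<close> are represented by functions that
  are \<^const>\<open>extensional\<close> on \<open>X\<close>, so that equality in the group is equality of maps on \<open>X\<close>.\<close>

definition shift_aut :: "'a set \<Rightarrow> (int \<Rightarrow> 'a) set \<Rightarrow> ((int \<Rightarrow> 'a) \<Rightarrow> (int \<Rightarrow> 'a)) set"
  where "shift_aut A X =
    {\<phi> \<in> extensional X.
       homeomorphic_map (subtopology (full_shift A) X) (subtopology (full_shift A) X) \<phi> \<and>
       (\<forall>x\<in>X. \<phi> (shift x) = shift (\<phi> x))}"

definition Aut_shift :: "'a set \<Rightarrow> (int \<Rightarrow> 'a) set \<Rightarrow> ((int \<Rightarrow> 'a) \<Rightarrow> (int \<Rightarrow> 'a)) monoid"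
  where "Aut_shift A X = (BijGroup X) \<lparr>carrier := shift_aut A X\<rparr>"

text \<open>Words are formal: they are lists over the two-letter alphabet \<^typ>\<open>bool\<close>, the letters
  \<^const>\<open>True\<close> and \<^const>\<open>False\<close> standing for \<open>g\<^sub>1\<close> and \<open>g\<^sub>2\<close>. In particular \<open>g\<^sub>1 = g\<^sub>2\<close>
  never gives a free semigroup.\<close>

definition word_value :: "('g, 'm) monoid_scheme \<Rightarrow> 'g \<Rightarrow> 'g \<Rightarrow> bool list \<Rightarrow> 'g"
  where "word_value G g\<^sub>1 g\<^sub>2 w =
    foldr (\<otimes>\<^bsub>G\<^esub>) (map (\<lambda>b. if b then g\<^sub>1 else g\<^sub>2) w) \<one>\<^bsub>G\<^esub>"

definition contains_free_semigroup2 :: "('g, 'm) monoid_scheme \<Rightarrow> bool"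
  where "contains_free_semigroup2 G \<longleftrightarrow>
    (\<exists>g\<^sub>1\<in>carrier G. \<exists>g\<^sub>2\<in>carrier G. inj_on (word_value G g\<^sub>1 g\<^sub>2) {w. w \<noteq> []})"

lemma topspace_full_shift: "topspace (full_shift A) = {x. range x \<subseteq> A}"
  by (auto simp: full_shift_def PiE_def Pi_def)

lemma subshift_subset: "subshift A X \<Longrightarrow> X \<subseteq> topspace (full_shift A)"
  by (simp add: subshift_def closedin_subset)

lemma finite_language:
  assumes "finite A" "subshift A X"
  shows "finite (language X n)"
proof (rule finite_subset)
  show "language X n \<subseteq> {w. set w \<subseteq> A \<and> length w = n}"
  proof clarify
    fix w assume "w \<in> language X n"
    then obtain x where len: "length w = n" and x: "x \<in> X" "\<forall>i<n. x (int i) = w ! i"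
      by (auto simp: language_def)
    have "x j \<in> A" for j
      using subshift_subset[OF assms(2)] x(1) unfolding topspace_full_shift by blast
    then have "w ! i \<in> A" if "i < n" for i
      using x(2) that by metis
    then show "set w \<subseteq> A \<and> length w = n"
      using len by (auto simp: in_set_conv_nth)
  qed
  show "finite {w. set w \<subseteq> A \<and> length w = n}"
    using assms(1) by (rule finite_lists_length_eq)
qed

lemma shift_aut_subset_Bij:
  assumes "subshift A X"
  shows "shift_aut A X \<subseteq> Bij X"
proof -
  have "topspace (subtopology (full_shift A) X) = X"
    using subshift_subset[OF assms] by auto
  then show ?thesis
    by (auto simp: shift_aut_def Bij_def bij_betw_def homeomorphic_eq_everything_map)
qed

lemma group_Aut_shift:
  assumes X: "subshift A X"
  shows "group (Aut_shift A X)"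
proof -
  let ?T = "subtopology (full_shift A) X"
  have top: "topspace ?T = X"
    using subshift_subset[OF X] by auto
  have sX: "shift x \<in> X" if "x \<in> X" for x
    using X that by (auto simp: subshift_def)
  interpret B: group "BijGroup X" by (rule group_BijGroup)
  have Bij: "shift_aut A X \<subseteq> Bij X" by (rule shift_aut_subset_Bij[OF X])
  have "subgroup (shift_aut A X) (BijGroup X)"
  proof (rule B.subgroupI)
    show "shift_aut A X \<subseteq> carrier (BijGroup X)"
      using Bij by (simp add: BijGroup_def)
    have "(\<lambda>x\<in>X. x) \<in> shift_aut A X"
    proof -
      have "homeomorphic_map ?T ?T (\<lambda>x\<in>X. x)"
        by (rule homeomorphic_map_eq[of _ _ id]) auto
      then show ?thesis by (auto simp: shift_aut_def sX)
    qed
    then show "shift_aut A X \<noteq> {}" by blast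
  next
    fix f assume f: "f \<in> shift_aut A X"
    then have fB: "f \<in> Bij X" using Bij by blast
    then have bij: "bij_betw f X X" by (simp add: Bij_def)
    obtain g where g: "homeomorphic_maps ?T ?T f g"
      using f by (auto simp: shift_aut_def homeomorphic_map_maps)
    have inv: "inv_into X f y = g y" if "y \<in> X" for y
    proof (rule inv_into_f_eq)
      show "inj_on f X" using bij by (rule bij_betw_imp_inj_on)
      show "g y \<in> X" "f (g y) = y"
        using g that top unfolding homeomorphic_maps_def continuous_map_def by blast+
    qed
    have "homeomorphic_map ?T ?T g"
      using g homeomorphic_maps_sym homeomorphic_maps_map by blast
    then have hom: "homeomorphic_map ?T ?T (\<lambda>x\<in>X. inv_into X f x)"
      by (rule homeomorphic_map_eq) (use top inv in auto)
    have comm: "inv_into X f (shift y) = shift (inv_into X f y)" if "y \<in> X" for y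
    proof (rule inv_into_f_eq)
      show "inj_on f X" using bij by (rule bij_betw_imp_inj_on)
      have iy: "inv_into X f y \<in> X" "f (inv_into X f y) = y"
        using bij that by (auto simp: bij_betw_def inv_into_into f_inv_into_f)
      show "shift (inv_into X f y) \<in> X" using iy sX by blast
      show "f (shift (inv_into X f y)) = shift y"
        using f iy by (auto simp: shift_aut_def)
    qed
    show "inv\<^bsub>BijGroup X\<^esub> f \<in> shift_aut A X"
      using hom comm sX by (simp add: inv_BijGroup[OF fB] shift_aut_def)
  next
    fix f g assume f: "f \<in> shift_aut A X" and g: "g \<in> shift_aut A X"
    have gX: "g x \<in> X" if "x \<in> X" for x
      using g Bij that by (auto simp: Bij_def bij_betw_def)
    have "homeomorphic_map ?T ?T (f \<circ> g)"
      using f g by (auto simp: shift_aut_def intro: homeomorphic_map_compose)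
    then have "homeomorphic_map ?T ?T (compose X f g)"
      by (rule homeomorphic_map_eq) (use top in \<open>auto simp: compose_def\<close>)
    then have "compose X f g \<in> shift_aut A X"
      using f g gX sX by (auto simp: shift_aut_def compose_def)
    then show "f \<otimes>\<^bsub>BijGroup X\<^esub> g \<in> shift_aut A X"
      using f g Bij by (auto simp: BijGroup_def)
  qed
  then show ?thesis
    unfolding Aut_shift_def by (rule B.subgroup_imp_group)
qed

text \<open>In a group it makes no difference whether the empty word is admitted.\<close>

lemma (in group) inj_word_value_iff:
  assumes g: "g\<^sub>1 \<in> carrier G" "g\<^sub>2 \<in> carrier G"
  shows "inj (word_value G g\<^sub>1 g\<^sub>2) \<longleftrightarrow> inj_on (word_value G g\<^sub>1 g\<^sub>2) {w. w \<noteq> []}"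
proof
  assume "inj (word_value G g\<^sub>1 g\<^sub>2)"
  then show "inj_on (word_value G g\<^sub>1 g\<^sub>2) {w. w \<noteq> []}"
    by (rule inj_on_subset) simp
next
  let ?v = "word_value G g\<^sub>1 g\<^sub>2"
  assume inj: "inj_on ?v {w. w \<noteq> []}"
  have Cons: "?v (b # w) = (if b then g\<^sub>1 else g\<^sub>2) \<otimes> ?v w" for b w
    by (simp add: word_value_def)
  have closed: "?v w \<in> carrier G" for w
    by (induction w) (use g in \<open>auto simp: word_value_def\<close>)
  show "inj ?v"
  proof (rule injI)
    fix u w assume "?v u = ?v w"
    then have "?v (True # u) = ?v (True # w)" by (simp add: Cons)
    then show "u = w" using inj_onD[OF inj] by blast
  qed
qed

end

theory Submission
  imports Defs
begin

text \<open>
  For an automorphism \<open>\<phi>\<close> and a point \<open>x\<close>, consider the space-time diagram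
  \<open>\<eta> s j = (\<phi>\<^sup>s x) j\<close>. If \<open>P\<^sub>X n < K\<^sup>2\<close> with \<open>K\<close> a small fraction of \<open>n\<close>, the pigeonhole
  principle yields, around every position, a period vector of size at most \<open>K\<close> that is
  valid on a box much larger than \<open>K\<close>. If such a local period \<open>v\<close> is not global, the boundary
  of the region of agreement between \<open>\<eta>\<close> and its translate by \<open>v\<close> is a path crossing all rows.
  The local periods at the path preserve it, so it follows a straight line up to a bounded
  error and a strip around it is periodic along that line. Periodicity in that direction spreads
  from strip to strip: a local period transversal to the direction transports the period of the
  old strip to the new one, and a parallel local period is itself of the required kind. The strips
  may have different periods, but all of these are at most \<open>K\<close> rows high, so \<open>K!\<close> serves them all.

  Hence for each \<open>\<phi>\<close> some power \<open>\<phi>\<^sup>N\<close> with \<open>N > 0\<close> maps every point \<open>x\<close> to a translate \<open>\<sigma>\<^sup>b x\<close>, where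
  \<open>b\<close> may depend on \<open>x\<close>. Two such maps commute, which gives a relation between positive words.
\<close>

section \<open>Local and global periods\<close>

lemma periodic_mod:
  fixes f :: "int \<Rightarrow> 'b"
  assumes per: "\<And>s. f (s + p) = f s"
  shows "f s = f (s mod p)"
proof -
  have up: "f (t + p * int n) = f t" for t n
  proof (induction n)
    case (Suc n)
    then show ?case using per[of "t + p * int n"] by (simp add: algebra_simps)
  qed simp
  show ?thesis
  proof (cases "0 \<le> s div p")
    case True
    then show ?thesis using up[of "s mod p" "nat (s div p)"] by simp
  next
    case False
    then have "s + p * int (nat (- (s div p))) = s mod p"
      by (simp add: algebra_simps minus_mult_div_eq_mod)
    then show ?thesis using up[of s "nat (- (s div p))"] by metis
  qed
qed

text \<open>To the right of \<open>0\<close>, a period \<open>a\<close> of the window around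
  \<open>n\<close> reduces the claim at \<open>n\<close> to the claim at \<open>n - a\<close>. To
  the left, a period of the window starting at \<open>- n\<close> reduces it to
  \<open>- n + a\<close>, which is nearer to \<open>0\<close> or already beyond it. A window of
  length \<open>2 * K\<close> has room for the reduced point and for its translate by
  \<open>p\<close>.\<close>

lemma periodic_if_locally_periodic:
  fixes f :: "int \<Rightarrow> 'b" and K p :: int
  assumes loc: "\<And>s. \<exists>a. 0 < a \<and> a \<le> K \<and> (\<forall>t\<in>{s..s + 2 * K}. f (t + a) = f t)"
    and p: "0 < p" "p \<le> K" "\<forall>t\<in>{0..2 * K}. f (t + p) = f t"
  shows "f (t + p) = f t"
proof -
  have up: "f (int n + p) = f (int n)" for n
  proof (induction n rule: less_induct)
    case (less n)
    show ?case
    proof (cases "int n \<le> 2 * K")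
      case True
      then show ?thesis using p(3) by auto
    next
      case False
      obtain a where a: "0 < a" "a \<le> K" "\<forall>t\<in>{int n - K..int n - K + 2 * K}. f (t + a) = f t"
        using loc by blast
      have "f (int n) = f (int n - a)"
        using bspec[OF a(3), of "int n - a"] a p by simp
      also have "\<dots> = f (int n - a + p)"
        using less.IH[of "nat (int n - a)"] a p False by simp
      also have "\<dots> = f (int n + p)"
        using bspec[OF a(3), of "int n - a + p"] a p by (simp add: algebra_simps)
      finally show ?thesis by simp
    qed
  qed
  have down: "f (- int n + p) = f (- int n)" for n
  proof (induction n rule: less_induct)
    case (less n)
    show ?case
    proof (cases "n = 0")
      case True
      then show ?thesis using up[of 0] by simp
    next
      case False
      let ?t = "- int n"
      obtain a where a: "0 < a" "a \<le> K" "\<forall>t\<in>{?t..?t + 2 * K}. f (t + a) = f t"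
        using loc by blast
      have "f (?t + a + p) = f (?t + a)"
      proof (cases "?t + a < 0")
        case True
        then show ?thesis using less.IH[of "nat (- (?t + a))"] a by simp
      next
        case False
        then show ?thesis using up[of "nat (?t + a)"] by simp
      qed
      moreover have "f (?t + a) = f ?t"
        using bspec[OF a(3), of ?t] a p by simp
      moreover have "f (?t + a + p) = f (?t + p)"
        using bspec[OF a(3), of "?t + p"] a p by (simp add: algebra_simps)
      ultimately show ?thesis by simp
    qed
  qed
  show ?thesis
    by (cases t) (use up down in \<open>auto simp del: of_nat_Suc\<close>)
qed

section \<open>Plane configurations with a local rule, and their symmetries\<close>

text \<open>Rows of a plane configuration such that each row determines the next and the previous one
  by a rule of radius \<open>R\<close>, expressed only through agreement of translated rows.\<close>

locale ca_plane =
  fixes \<eta> :: "int \<Rightarrow> int \<Rightarrow> 'a" and R :: int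
  assumes R: "1 \<le> R"
    and up: "\<And>s a b l h. (\<And>j. l \<le> j \<Longrightarrow> j \<le> h \<Longrightarrow> \<eta> s j = \<eta> (s + a) (j + b)) \<Longrightarrow>
      (\<And>j. l + R \<le> j \<Longrightarrow> j \<le> h - R \<Longrightarrow> \<eta> (s + 1) j = \<eta> (s + 1 + a) (j + b))"
    and down: "\<And>s a b l h. (\<And>j. l \<le> j \<Longrightarrow> j \<le> h \<Longrightarrow> \<eta> s j = \<eta> (s + a) (j + b)) \<Longrightarrow>
      (\<And>j. l + R \<le> j \<Longrightarrow> j \<le> h - R \<Longrightarrow> \<eta> (s - 1) j = \<eta> (s - 1 + a) (j + b))"
begin

text \<open>Each row moved away from \<open>s\<close>, upwards or downwards, costs \<open>R\<close>
  positions at both ends of the interval of agreement.\<close>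

lemma cone:
  assumes "\<And>j. l \<le> j \<Longrightarrow> j \<le> h \<Longrightarrow> \<eta> s j = \<eta> (s + a) (j + b)"
    and "l + R * \<bar>t - s\<bar> \<le> j" "j \<le> h - R * \<bar>t - s\<bar>"
  shows "\<eta> t j = \<eta> (t + a) (j + b)"
proof -
  have up': "\<forall>j. l + R * int n \<le> j \<longrightarrow> j \<le> h - R * int n \<longrightarrow>
      \<eta> (s + int n) j = \<eta> (s + int n + a) (j + b)" for n
  proof (induction n)
    case (Suc n)
    show ?case
      using up[of "l + R * int n" "h - R * int n" "s + int n" a b] Suc
      by (simp add: algebra_simps)
  qed (use assms(1) in simp)
  have down': "\<forall>j. l + R * int n \<le> j \<longrightarrow> j \<le> h - R * int n \<longrightarrow>
      \<eta> (s - int n) j = \<eta> (s - int n + a) (j + b)" for n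
  proof (induction n)
    case (Suc n)
    show ?case
      using down[of "l + R * int n" "h - R * int n" "s - int n" a b] Suc
      by (simp add: algebra_simps)
  qed (use assms(1) in simp)
  show ?thesis
  proof (cases "s \<le> t")
    case True
    then show ?thesis using up'[of "nat (t - s)"] assms(2,3) by simp
  next
    case False
    then show ?thesis using down'[of "nat (s - t)"] assms(2,3) by simp
  qed
qed

lemma row_period_global:
  assumes "\<And>j. \<eta> s j = \<eta> (s + a) (j + b)"
  shows "\<eta> t j = \<eta> (t + a) (j + b)"
  by (rule cone[of "j - R * \<bar>t - s\<bar>" "j + R * \<bar>t - s\<bar>" s]) (use assms in auto)

text \<open>Reversing time exchanges \<open>up\<close> and \<open>down\<close>, so boundary paths
  need only be built upwards.\<close>

lemma ca_plane_flip: "ca_plane (\<lambda>s. \<eta> (- s)) R"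
proof
  fix s a b l h j
  assume *: "\<And>j. l \<le> j \<Longrightarrow> j \<le> h \<Longrightarrow> \<eta> (- s) j = \<eta> (- (s + a)) (j + b)"
    and j: "l + R \<le> j" "j \<le> h - R"
  have "\<And>j. l \<le> j \<Longrightarrow> j \<le> h \<Longrightarrow> \<eta> (- s) j = \<eta> (- s + - a) (j + b)" using * by simp
  moreover have "- (s + 1) = - s - 1" "- (s + 1 + a) = - s - 1 + - a"
    "- (s - 1) = - s + 1" "- (s - 1 + a) = - s + 1 + - a" by simp_all
  ultimately show "\<eta> (- (s + 1)) j = \<eta> (- (s + 1 + a)) (j + b)"
       "\<eta> (- (s - 1)) j = \<eta> (- (s - 1 + a)) (j + b)"
    using up[OF _ j, of "- s" "- a" b] down[OF _ j, of "- s" "- a" b] by (simp_all only:)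
qed (rule R)

text \<open>With this symmetry only disagreements to the right of the origin need to be
  studied.\<close>

lemma ca_plane_mirror: "ca_plane (\<lambda>s j. \<eta> s (- j)) R"
proof
  fix s a b l h j
  assume *: "\<And>j. l \<le> j \<Longrightarrow> j \<le> h \<Longrightarrow> \<eta> s (- j) = \<eta> (s + a) (- (j + b))"
    and j: "l + R \<le> j" "j \<le> h - R"
  have **: "\<And>j. - h \<le> j \<Longrightarrow> j \<le> - l \<Longrightarrow> \<eta> s j = \<eta> (s + a) (j + - b)"
    using *[of "- j" for j] by (simp add: algebra_simps)
  have j': "- h + R \<le> - j" "- j \<le> - l - R" using j by auto
  from up[OF ** j'] down[OF ** j']
  show "\<eta> (s + 1) (- j) = \<eta> (s + 1 + a) (- (j + b))"
       "\<eta> (s - 1) (- j) = \<eta> (s - 1 + a) (- (j + b))" by (simp_all add: algebra_simps)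
qed (rule R)

end

text \<open>The period is demanded on a piece of a single row; \<open>cone\<close> thickens it to a
  box. The factor \<open>100\<close> is a generous margin, from which all later windows are
  cut.\<close>

locale locally_periodic_plane = ca_plane +
  fixes K :: int
  assumes K: "1 \<le> K"
    and local_period: "\<And>s i. \<exists>a b. (a, b) \<noteq> (0, 0) \<and> \<bar>a\<bar> \<le> K \<and> \<bar>b\<bar> \<le> K \<and>
      (\<forall>j. \<bar>j - i\<bar> \<le> 100 * (R * K) \<longrightarrow> \<eta> s j = \<eta> (s + a) (j + b))"
begin

text \<open>The horizontal distance that information can travel within \<open>K\<close> rows; it is
  the unit for all horizontal estimates.\<close>

definition L :: int where "L = R * K"

lemma L_ge: "K \<le> L" "R \<le> L" "1 \<le> L"
proof -
  have "1 * K \<le> R * K" "R * 1 \<le> R * K" using K R by (intro mult_mono; simp)+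
  then show "K \<le> L" "R \<le> L" by (simp_all add: L_def)
  then show "1 \<le> L" using K by linarith
qed

lemma R_mult_le: "x \<le> n * K \<Longrightarrow> R * x \<le> n * L"
  using mult_left_mono[of x "n * K" R] R by (simp add: L_def algebra_simps)

lemma locally_periodic_flip: "locally_periodic_plane (\<lambda>s. \<eta> (- s)) R K"
proof -
  interpret F: ca_plane "\<lambda>s. \<eta> (- s)" R by (rule ca_plane_flip)
  show ?thesis
  proof
    fix s i
    obtain a b where ab: "(a, b) \<noteq> (0, 0)" "\<bar>a\<bar> \<le> K" "\<bar>b\<bar> \<le> K"
      "\<forall>j. \<bar>j - i\<bar> \<le> 100 * (R * K) \<longrightarrow> \<eta> (- s) j = \<eta> (- s + a) (j + b)"
      using local_period by blast
    show "\<exists>a b. (a, b) \<noteq> (0, 0) \<and> \<bar>a\<bar> \<le> K \<and> \<bar>b\<bar> \<le> K \<and>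
      (\<forall>j. \<bar>j - i\<bar> \<le> 100 * (R * K) \<longrightarrow> \<eta> (- s) j = \<eta> (- (s + a)) (j + b))"
      by (rule exI[of _ "- a"], rule exI[of _ b]) (use ab in auto)
  qed (rule K)
qed

lemma locally_periodic_mirror: "locally_periodic_plane (\<lambda>s j. \<eta> s (- j)) R K"
proof -
  interpret F: ca_plane "\<lambda>s j. \<eta> s (- j)" R by (rule ca_plane_mirror)
  show ?thesis
  proof
    fix s i
    obtain a b where ab: "(a, b) \<noteq> (0, 0)" "\<bar>a\<bar> \<le> K" "\<bar>b\<bar> \<le> K"
      "\<forall>j. \<bar>j - (- i)\<bar> \<le> 100 * (R * K) \<longrightarrow> \<eta> s j = \<eta> (s + a) (j + b)"
      using local_period by blast
    have "\<eta> s (- j) = \<eta> (s + a) (- (j + - b))" if "\<bar>j - i\<bar> \<le> 100 * (R * K)" for j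
      using ab(4)[rule_format, of "- j"] that by (simp add: algebra_simps)
    then show "\<exists>a b. (a, b) \<noteq> (0, 0) \<and> \<bar>a\<bar> \<le> K \<and> \<bar>b\<bar> \<le> K \<and>
      (\<forall>j. \<bar>j - i\<bar> \<le> 100 * (R * K) \<longrightarrow> \<eta> s (- j) = \<eta> (s + a) (- (j + b)))"
      by (intro exI[of _ a] exI[of _ "- b"]) (use ab in auto)
  qed (rule K)
qed

lemma box_period:
  obtains a b where "0 \<le> a" "a \<le> K" "\<bar>b\<bar> \<le> K" "a = 0 \<Longrightarrow> b \<noteq> 0"
    "\<And>t j. \<bar>t - s\<bar> \<le> 10 * K \<Longrightarrow> \<bar>j - i\<bar> \<le> 50 * L \<Longrightarrow> \<eta> (t + a) (j + b) = \<eta> t j"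
proof -
  obtain a b where ab: "(a, b) \<noteq> (0, 0)" "\<bar>a\<bar> \<le> K" "\<bar>b\<bar> \<le> K"
      "\<forall>j. \<bar>j - i\<bar> \<le> 100 * L \<longrightarrow> \<eta> s j = \<eta> (s + a) (j + b)"
    using local_period unfolding L_def by blast
  \<comment> \<open>The box is larger by \<open>K\<close> rows and \<open>L\<close> columns than the
    one claimed, so that the vector may be replaced by its negative when \<open>a < 0\<close>. It
    fits because \<open>11 * K\<close> rows cost \<open>11 * L\<close> columns and
    \<open>51 + 11 \<le> 100\<close>.\<close>
  have *: "\<eta> t j = \<eta> (t + a) (j + b)" if "\<bar>t - s\<bar> \<le> 11 * K" "\<bar>j - i\<bar> \<le> 51 * L" for t j
    by (rule cone[of "i - 100 * L" "i + 100 * L" s])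
      (use ab that R_mult_le[OF that(1)] in auto)
  show ?thesis
  proof (cases "0 \<le> a")
    case True
    show ?thesis
      by (rule that[of a b]) (use True ab * L_ge K in force)+
  next
    case False
    have "\<eta> (t + - a) (j + - b) = \<eta> t j"
      if "\<bar>t - s\<bar> \<le> 10 * K" "\<bar>j - i\<bar> \<le> 50 * L" for t j
      using *[of "t - a" "j - b"] that ab L_ge by (simp add: abs_le_iff)
    then show ?thesis
      by (intro that[of "- a" "- b"]) (use False ab in auto)
  qed
qed

section \<open>The boundary of the agreement with a translate\<close>

definition dis :: "int \<Rightarrow> int \<Rightarrow> int \<Rightarrow> int \<Rightarrow> bool"
  where "dis a b s j \<longleftrightarrow> \<eta> s j \<noteq> \<eta> (s + a) (j + b)"

text \<open>The right end of a stretch of agreement. The length \<open>m\<close> of the stretch is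
  what makes the boundary locally unique and lets it be followed from row to row.\<close>

definition bdry :: "int \<Rightarrow> int \<Rightarrow> int \<Rightarrow> int \<Rightarrow> int \<Rightarrow> bool"
  where "bdry a b m s j \<longleftrightarrow> dis a b s j \<and> (\<forall>i. j - m \<le> i \<longrightarrow> i < j \<longrightarrow> \<not> dis a b s i)"

lemma bdry_mono: "bdry a b m s j \<Longrightarrow> m' \<le> m \<Longrightarrow> bdry a b m' s j"
  by (auto simp: bdry_def)

lemma bdry_unique: "bdry a b m s j \<Longrightarrow> bdry a b m s j' \<Longrightarrow> \<bar>j - j'\<bar> \<le> m \<Longrightarrow> j = j'"
  unfolding bdry_def by (cases j j' rule: linorder_cases) auto

lemma first_dis:
  assumes "dis a b s i" "l \<le> i"
  obtains j where "l \<le> j" "j \<le> i" "dis a b s j" "\<And>k. l \<le> k \<Longrightarrow> k < j \<Longrightarrow> \<not> dis a b s k"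
proof -
  have "dis a b s (l + int (nat (i - l)))" using assms by simp
  then obtain n where n: "dis a b s (l + int n)" "\<And>m. m < n \<Longrightarrow> \<not> dis a b s (l + int m)"
    using exists_least_iff[of "\<lambda>n. dis a b s (l + int n)"] by blast
  show ?thesis
  proof (cases "l + int n \<le> i")
    case True
    show ?thesis
    proof (rule that[of "l + int n"])
      fix k assume k: "l \<le> k" "k < l + int n"
      then have "nat (k - l) < n" by linarith
      from n(2)[OF this] show "\<not> dis a b s k" using k(1) by simp
    qed (use n(1) True in auto)
  next
    case False
    then have "nat (i - l) < n" using assms(2) by linarith
    from n(2)[OF this] show ?thesis using assms by simp
  qed
qed

text \<open>If row \<open>s + 1\<close> agreed within distance \<open>R\<close> of \<open>j\<close>,
  then \<open>down\<close> would give agreement at \<open>j\<close>; so the first disagreement from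
  \<open>j - R\<close> on is the new boundary. One \<open>R\<close> of the loss is due to the local
  rule, the other to a possible move to the left. The witness is chosen before \<open>m\<close>, so
  one path serves several agreement lengths.\<close>

lemma bdry_step:
  "\<exists>j'. \<forall>m\<ge>2 * R. bdry a b m s j \<longrightarrow> \<bar>j' - j\<bar> \<le> R \<and> bdry a b (m - 2 * R) (s + 1) j'"
proof (cases "dis a b s j")
  case True
  have "\<exists>i. j - R \<le> i \<and> i \<le> j + R \<and> dis a b (s + 1) i"
  proof (rule ccontr)
    assume "\<not> ?thesis"
    then have *: "\<eta> (s + 1) i = \<eta> (s + 1 + a) (i + b)" if "j - R \<le> i" "i \<le> j + R" for i
      using that by (auto simp: dis_def)
    have "\<not> dis a b s j"
      using down[OF *, where j = j] by (simp add: dis_def)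
    then show False using True by simp
  qed
  then obtain i where i: "j - R \<le> i" "i \<le> j + R" "dis a b (s + 1) i" by blast
  obtain j' where j': "j - R \<le> j'" "j' \<le> i" "dis a b (s + 1) j'"
    "\<And>k. j - R \<le> k \<Longrightarrow> k < j' \<Longrightarrow> \<not> dis a b (s + 1) k"
    using first_dis[OF i(3,1)] by blast
  have "\<bar>j' - j\<bar> \<le> R \<and> bdry a b (m - 2 * R) (s + 1) j'" if m: "2 * R \<le> m" "bdry a b m s j" for m
  proof -
    have ag: "\<eta> s k = \<eta> (s + a) (k + b)" if "j - m \<le> k" "k \<le> j - 1" for k
    proof -
      have "j - m \<le> k" "k < j" using that by simp_all
      then have "\<not> dis a b s k" using m(2) unfolding bdry_def by blast
      then show ?thesis by (simp add: dis_def)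
    qed
    have "\<not> dis a b (s + 1) k" if "j' - (m - 2 * R) \<le> k" "k < j'" for k
    proof (cases "j - R \<le> k")
      case True
      then show ?thesis using j'(4) that by blast
    next
      case False
      then have "j - m + R \<le> k" "k \<le> j - 1 - R" using that j' m by auto
      from up[OF ag this] show ?thesis by (simp add: dis_def)
    qed
    then have "bdry a b (m - 2 * R) (s + 1) j'"
      unfolding bdry_def using j'(3) by blast
    moreover have "\<bar>j' - j\<bar> \<le> R" using i j' by linarith
    ultimately show ?thesis by simp
  qed
  then show ?thesis by (intro exI[of _ j'] allI impI)
next
  case False
  then have "\<not> bdry a b m s j" for m by (simp add: bdry_def)
  then show ?thesis by simp
qed

text \<open>Both points compared by \<open>dis\<close> lie in the box on which \<open>(a, b)\<close>
  is a period.\<close>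

lemma dis_translate:
  assumes per: "\<And>t j. \<bar>t - s\<bar> \<le> 10 * K \<Longrightarrow> \<bar>j - i\<bar> \<le> 50 * L \<Longrightarrow> \<eta> (t + a) (j + b) = \<eta> t j"
    and v: "\<bar>a0\<bar> \<le> K" "\<bar>b0\<bar> \<le> K" and tj: "\<bar>t - s\<bar> \<le> 5 * K" "\<bar>j - i\<bar> \<le> 45 * L"
  shows "dis a0 b0 (t + a) (j + b) \<longleftrightarrow> dis a0 b0 t j"
proof -
  have "\<bar>t + a0 - s\<bar> \<le> 10 * K" "\<bar>j + b0 - i\<bar> \<le> 50 * L" "\<bar>t - s\<bar> \<le> 10 * K" "\<bar>j - i\<bar> \<le> 50 * L"
    using tj v K L_ge by linarith+
  then have "\<eta> (t + a) (j + b) = \<eta> t j" "\<eta> (t + a0 + a) (j + b0 + b) = \<eta> (t + a0) (j + b0)"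
    using per by blast+
  moreover have "t + a + a0 = t + a0 + a" "j + b + b0 = j + b0 + b" by simp_all
  ultimately show ?thesis unfolding dis_def by metis
qed

lemma bdry_translate:
  assumes per: "\<And>t j. \<bar>t - s\<bar> \<le> 10 * K \<Longrightarrow> \<bar>j - i\<bar> \<le> 50 * L \<Longrightarrow> \<eta> (t + a) (j + b) = \<eta> t j"
    and v: "\<bar>a0\<bar> \<le> K" "\<bar>b0\<bar> \<le> K" and tj: "\<bar>t - s\<bar> \<le> 5 * K" "\<bar>j - i\<bar> \<le> 20 * L"
    and bd: "bdry a0 b0 (20 * L) t j"
  shows "bdry a0 b0 (20 * L) (t + a) (j + b)"
proof -
  have tr: "dis a0 b0 (t + a) (k + b) \<longleftrightarrow> dis a0 b0 t k" if "j - 20 * L \<le> k" "k \<le> j" for k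
    by (rule dis_translate[OF per v tj(1)]) (use that tj in auto)
  have "\<not> dis a0 b0 (t + a) k" if "j + b - 20 * L \<le> k" "k < j + b" for k
    using tr[of "k - b"] bd that unfolding bdry_def by auto
  then show ?thesis using tr[of j] bd L_ge(3) unfolding bdry_def by auto
qed

text \<open>A nonzero horizontal period of both compared rows would carry the disagreement at
  \<open>i\<close> to \<open>i - \<bar>b\<bar>\<close>, inside the stretch of agreement.\<close>

lemma bdry_not_horizontal:
  assumes per: "\<And>j. \<bar>j - i\<bar> \<le> 50 * L \<Longrightarrow> \<eta> s (j + b) = \<eta> s j"
    and per0: "\<And>j. \<bar>j - i\<bar> \<le> 50 * L \<Longrightarrow> \<eta> (s + a0) (j + b) = \<eta> (s + a0) j"
    and v: "\<bar>b0\<bar> \<le> K" and b: "\<bar>b\<bar> \<le> K"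
    and bd: "bdry a0 b0 (20 * L) s i"
  shows "b = 0"
proof (rule ccontr)
  assume "b \<noteq> 0"
  have *: "dis a0 b0 s (j + b) = dis a0 b0 s j" if "\<bar>j - i\<bar> \<le> K" for j
  proof -
    have "\<eta> s (j + b) = \<eta> s j" by (rule per) (use that L_ge in linarith)
    moreover have "\<eta> (s + a0) (j + b0 + b) = \<eta> (s + a0) (j + b0)"
      by (rule per0) (use that v L_ge in linarith)
    moreover have "j + b + b0 = j + b0 + b" by simp
    ultimately show ?thesis by (simp only: dis_def)
  qed
  have ag: "\<not> dis a0 b0 s (i - \<bar>b\<bar>)"
  proof -
    have "i - 20 * L \<le> i - \<bar>b\<bar>" "i - \<bar>b\<bar> < i" using b L_ge \<open>b \<noteq> 0\<close> by linarith+
    then show ?thesis using bd unfolding bdry_def by blast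
  qed
  have "dis a0 b0 s i" using bd by (simp add: bdry_def)
  then show False
    using *[of i] *[of "i - b"] ag K b by (cases "b > 0") simp_all
qed

text \<open>At a boundary the local period has positive height and can therefore carry the boundary
  to other rows.\<close>

lemma bdry_period:
  assumes v: "\<bar>a0\<bar> \<le> K" "\<bar>b0\<bar> \<le> K" and bd: "bdry a0 b0 (20 * L) s i"
  obtains a b where "0 < a" "a \<le> K" "\<bar>b\<bar> \<le> K"
    "\<And>t j. \<bar>t - s\<bar> \<le> 10 * K \<Longrightarrow> \<bar>j - i\<bar> \<le> 50 * L \<Longrightarrow> \<eta> (t + a) (j + b) = \<eta> t j"
proof -
  obtain a b where ab: "0 \<le> a" "a \<le> K" "\<bar>b\<bar> \<le> K" "a = 0 \<Longrightarrow> b \<noteq> 0"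
    "\<And>t j. \<bar>t - s\<bar> \<le> 10 * K \<Longrightarrow> \<bar>j - i\<bar> \<le> 50 * L \<Longrightarrow> \<eta> (t + a) (j + b) = \<eta> t j"
    using box_period[of s i] by blast
  have "a \<noteq> 0"
  proof
    assume "a = 0"
    have "b = 0"
      by (rule bdry_not_horizontal[OF _ _ v(2) ab(3) bd])
        (use ab(5)[of s] ab(5)[of "s + a0"] v K \<open>a = 0\<close> in auto)
    then show False using ab(4) \<open>a = 0\<close> by simp
  qed
  then show ?thesis using that[of a b] ab by simp
qed

text \<open>Each step up a row costs \<open>2 * R\<close> of the agreement to the left of the boundary; a local period
  with \<open>a \<le> K\<close> carries the boundary up from a lower row and thereby restores the full length.\<close>

lemma bdry_path_up:
  assumes v: "\<bar>a0\<bar> \<le> K" "\<bar>b0\<bar> \<le> K" and bd: "bdry a0 b0 (100 * L) 0 j0"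
  shows "\<exists>e :: nat \<Rightarrow> int. e 0 = j0 \<and> (\<forall>n. bdry a0 b0 (20 * L) (int n) (e n)) \<and>
    (\<forall>n. \<bar>e (Suc n) - e n\<bar> \<le> R)"
proof -
  \<comment> \<open>The boundary property is only a premise inside the choice, so the path exists
    unconditionally; that it stays on the boundary is proved afterwards.\<close>
  have "\<exists>e. \<forall>n. (n = 0 \<longrightarrow> e n = j0) \<and> (\<forall>m\<ge>2 * R. bdry a0 b0 m (int n) (e n) \<longrightarrow>
    \<bar>e (Suc n) - e n\<bar> \<le> R \<and> bdry a0 b0 (m - 2 * R) (int (Suc n)) (e (Suc n)))"
  proof (rule dependent_nat_choice)
    fix j :: int and n :: nat
    show "\<exists>j'. (Suc n = 0 \<longrightarrow> j' = j0) \<and> (\<forall>m\<ge>2 * R. bdry a0 b0 m (int n) j \<longrightarrow>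
       \<bar>j' - j\<bar> \<le> R \<and> bdry a0 b0 (m - 2 * R) (int (Suc n)) j')"
      using bdry_step[of a0 b0 "int n" j] by (simp add: add.commute)
  qed simp
  then obtain e :: "nat \<Rightarrow> int" where e0: "e 0 = j0" and
    e: "\<And>n m. 2 * R \<le> m \<Longrightarrow> bdry a0 b0 m (int n) (e n) \<Longrightarrow>
      \<bar>e (Suc n) - e n\<bar> \<le> R \<and> bdry a0 b0 (m - 2 * R) (int (Suc n)) (e (Suc n))"
    by blast
  \<comment> \<open>The first \<open>K\<close> rows live on the initial reserve: of
    \<open>100 * L\<close> they use up at most \<open>2 * L\<close>.\<close>
  have init: "bdry a0 b0 (100 * L - 2 * (R * int n)) (int n) (e n)" if "int n \<le> K" for n
    using that
  proof (induction n)
    case (Suc n)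
    have "R * int n \<le> 1 * L" by (rule R_mult_le) (use Suc.prems in simp)
    then show ?case
      using e[of "100 * L - 2 * (R * int n)" n] Suc L_ge R K by (simp add: algebra_simps)
  qed (use bd e0 in simp)
  have all: "bdry a0 b0 (20 * L) (int n) (e n)" for n
  proof (induction n rule: less_induct)
    case (less n)
    show ?case
    proof (cases "int n \<le> K")
      case True
      have "R * int n \<le> 1 * L" by (rule R_mult_le) (use True in simp)
      then show ?thesis using bdry_mono[OF init[OF True]] L_ge(3) by simp
    next
      case False
      then obtain n' where n: "n = Suc n'" using K by (cases n) auto
      have R20: "2 * R \<le> 20 * L" using L_ge R by simp
      have bd': "bdry a0 b0 (20 * L) (int n') (e n')" using less n by simp
      obtain a b where ab: "0 < a" "a \<le> K" "\<bar>b\<bar> \<le> K"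
        "\<And>t j. \<bar>t - int n'\<bar> \<le> 10 * K \<Longrightarrow> \<bar>j - e n'\<bar> \<le> 50 * L \<Longrightarrow> \<eta> (t + a) (j + b) = \<eta> t j"
        using bdry_period[OF v bd'] by blast
      have lip: "\<bar>e n' - e k\<bar> \<le> R * (int n' - int k)" if "k \<le> n'" for k
        using that
      proof (induction rule: inc_induct)
        case (step k)
        have "bdry a0 b0 (20 * L) (int k) (e k)" using less n step by simp
        then have "\<bar>e (Suc k) - e k\<bar> \<le> R" using e[OF R20] by blast
        moreover have "R * (int n' - int k) = R * (int n' - int (Suc k)) + R"
          by (simp add: algebra_simps)
        ultimately show ?case using step.IH by linarith
      qed simp
      \<comment> \<open>The row from which the local period of height \<open>a\<close> leads exactly
        to row \<open>n\<close>.\<close>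
      define k where "k = nat (int n - a)"
      have k: "int k = int n - a" "k \<le> n'" "k < n" using ab False n by (auto simp: k_def)
      have Rk: "R * (int n' - int k) \<le> 1 * L" by (rule R_mult_le) (use k n ab in simp)
      have "bdry a0 b0 (20 * L) (int k + a) (e k + b)"
        by (rule bdry_translate[OF ab(4) v])
          (use k n ab K Rk lip[OF k(2)] less.IH[of k] L_ge in \<open>linarith | simp\<close>)+
      then have c: "bdry a0 b0 (20 * L) (int n) (e k + b)" using k by simp
      have en: "\<bar>e n - e n'\<bar> \<le> R" "bdry a0 b0 (20 * L - 2 * R) (int n) (e n)"
        using e[OF R20 bd'] n by auto
      \<comment> \<open>Both points are boundaries of row \<open>n\<close> with agreement length
        \<open>20 * L - 2 * R\<close> and are close together, hence equal; the translated one has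
        the full length \<open>20 * L\<close>.\<close>
      have "e n = e k + b"
      proof (rule bdry_unique[OF en(2)])
        show "bdry a0 b0 (20 * L - 2 * R) (int n) (e k + b)"
          by (rule bdry_mono[OF c]) (use R in simp)
        show "\<bar>e n - (e k + b)\<bar> \<le> 20 * L - 2 * R"
          using en(1) lip[OF k(2)] Rk ab(3) L_ge by linarith
      qed
      then show ?thesis using c by simp
    qed
  qed
  have "\<bar>e (Suc n) - e n\<bar> \<le> R" for n
    using e[OF _ all] L_ge R by simp
  then show ?thesis using e0 all by blast
qed

text \<open>The lower half of the path comes from the time-reversed plane, where the vector
  \<open>(a0, b0)\<close> becomes \<open>(- a0, b0)\<close>.\<close>

lemma bdry_path:
  assumes v: "\<bar>a0\<bar> \<le> K" "\<bar>b0\<bar> \<le> K" and bd: "bdry a0 b0 (100 * L) 0 j0"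
  shows "\<exists>e :: int \<Rightarrow> int. (\<forall>s. bdry a0 b0 (20 * L) s (e s)) \<and> (\<forall>s. \<bar>e (s + 1) - e s\<bar> \<le> R)"
proof -
  interpret F: locally_periodic_plane "\<lambda>s. \<eta> (- s)" R K by (rule locally_periodic_flip)
  have flip: "F.bdry (- a0) b0 m s j = bdry a0 b0 m (- s) j" for m s j
    by (simp add: F.bdry_def F.dis_def bdry_def dis_def add.commute)
  obtain f where f: "f 0 = j0" "\<And>n. bdry a0 b0 (20 * L) (int n) (f n)"
    "\<And>n. \<bar>f (Suc n) - f n\<bar> \<le> R"
    using bdry_path_up[OF assms] by blast
  obtain g where g: "g 0 = j0" "\<And>n. bdry a0 b0 (20 * L) (- int n) (g n)"
    "\<And>n. \<bar>g (Suc n) - g n\<bar> \<le> R"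
    using F.bdry_path_up[of "- a0" b0 j0] v bd unfolding flip by auto
  define e where "e s = (if 0 \<le> s then f (nat s) else g (nat (- s)))" for s
  have "bdry a0 b0 (20 * L) s (e s)" for s
    using f(2)[of "nat s"] g(2)[of "nat (- s)"] by (cases "0 \<le> s") (simp_all add: e_def)
  moreover have "\<bar>e (s + 1) - e s\<bar> \<le> R" for s
  proof -
    consider "0 \<le> s" | "s = - 1" | "s < - 1" by linarith
    then show ?thesis
    proof cases
      case 1
      then show ?thesis using f(3)[of "nat s"] by (simp add: e_def nat_add_distrib)
    next
      case 2
      then show ?thesis using g(3)[of 0] f(1) g(1) by (simp add: e_def abs_minus_commute)
    next
      case 3
      then have "nat (- s) = Suc (nat (- (s + 1)))" by simp
      then show ?thesis using 3 g(3)[of "nat (- (s + 1))"] by (simp add: e_def abs_minus_commute)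
    qed
  qed
  ultimately show ?thesis by blast
qed

section \<open>Periodic strips\<close>

lemma path_lipschitz:
  assumes "\<And>s. \<bar>e (s + 1) - e s\<bar> \<le> R"
  shows "\<bar>e t - e s\<bar> \<le> R * \<bar>t - s\<bar>"
proof -
  have *: "\<bar>e (s + int n) - e s\<bar> \<le> R * int n" for s n
  proof (induction n)
    case (Suc n)
    then show ?case using assms[of "s + int n"] by (simp add: algebra_simps)
  qed simp
  show ?thesis
    using *[of s "nat (t - s)"] *[of t "nat (s - t)"]
    by (cases "s \<le> t") (simp_all add: abs_minus_commute)
qed

text \<open>The slope of the path together with the symbols around it is a one-dimensional sequence.
  Local periods at the path preserve the path, so this sequence is locally periodic and hence
  periodic.\<close>

lemma path_period:
  assumes v: "\<bar>a0\<bar> \<le> K" "\<bar>b0\<bar> \<le> K"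
    and bd: "\<And>s. bdry a0 b0 (20 * L) s (e s)" and lip: "\<And>s. \<bar>e (s + 1) - e s\<bar> \<le> R"
  shows "\<exists>p c. 0 < p \<and> p \<le> K \<and> (\<forall>s. e (s + p) = e s + c) \<and>
    (\<forall>s j. \<bar>j - e s\<bar> \<le> 10 * L \<longrightarrow> \<eta> (s + p) (j + c) = \<eta> s j)"
proof -
  \<comment> \<open>The value \<open>undefined\<close> outside the window makes equality of the
    second components mean agreement on the window only.\<close>
  define f where "f s = (e (s + 1) - e s, \<lambda>j. if \<bar>j\<bar> \<le> 10 * L then \<eta> s (e s + j) else undefined)" for s
  have loc: "\<exists>a b. 0 < a \<and> a \<le> K \<and> (\<forall>t\<in>{s..s + 2 * K}. f (t + a) = f t) \<and> e (s + a) = e s + b" for s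
  proof -
    obtain a b where ab: "0 < a" "a \<le> K" "\<bar>b\<bar> \<le> K"
      "\<And>t j. \<bar>t - s\<bar> \<le> 10 * K \<Longrightarrow> \<bar>j - e s\<bar> \<le> 50 * L \<Longrightarrow> \<eta> (t + a) (j + b) = \<eta> t j"
      using bdry_period[OF v bd[of s]] by blast
    have near: "\<bar>e t - e s\<bar> \<le> 3 * L" if "t \<in> {s..s + 3 * K}" for t
    proof -
      have "R * \<bar>t - s\<bar> \<le> 3 * L" by (rule R_mult_le) (use that in auto)
      then show ?thesis using path_lipschitz[of e, OF lip, of t s] by linarith
    qed
    \<comment> \<open>One row more than \<open>2 * K\<close>, since \<open>f t\<close> also involves
      \<open>e (t + 1)\<close>.\<close>
    have shift: "e (t + a) = e t + b" if t: "t \<in> {s..s + 2 * K + 1}" for t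
    proof (rule bdry_unique[OF bd])
      have Ra: "R * a \<le> 1 * L" by (rule R_mult_le) (use ab in simp)
      show "bdry a0 b0 (20 * L) (t + a) (e t + b)"
        by (rule bdry_translate[OF ab(4) v]) (use bd near[of t] t K in auto)
      show "\<bar>e (t + a) - (e t + b)\<bar> \<le> 20 * L"
        using path_lipschitz[of e, OF lip, of "t + a" t] Ra ab L_ge by (simp add: abs_le_iff)
    qed
    have "f (t + a) = f t" if t: "t \<in> {s..s + 2 * K}" for t
    proof -
      have "\<eta> (t + a) (e (t + a) + j) = \<eta> t (e t + j)" if "\<bar>j\<bar> \<le> 10 * L" for j
        using ab(4)[of t "e t + j"] shift[of t] near[of t] that t K by (simp add: abs_le_iff algebra_simps)
      then show ?thesis
        using shift[of t] shift[of "t + 1"] t by (auto simp: f_def algebra_simps)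
    qed
    then show ?thesis using ab shift[of s] K by auto
  qed
  obtain p c where p: "0 < p" "p \<le> K" "\<forall>t\<in>{0..0 + 2 * K}. f (t + p) = f t" "e (0 + p) = e 0 + c"
    using loc[of 0] by blast
  have per: "f (t + p) = f t" for t
    by (rule periodic_if_locally_periodic[of K]) (use loc p in \<open>blast, auto\<close>)
  have step: "e (s + p + 1) - e (s + p) = e (s + 1) - e s" for s
    using per[of s] by (simp add: f_def)
  have "e (s + p) = e s + c" for s
  proof (induction s rule: int_induct[of _ 0])
    case base
    then show ?case using p by simp
  next
    case (step1 i)
    then show ?case using step[of i] by (simp add: algebra_simps)
  next
    case (step2 i)
    then show ?case using step[of "i - 1"] by (simp add: algebra_simps)
  qed
  moreover have "\<eta> (s + p) (j + c) = \<eta> s j" if "\<bar>j - e s\<bar> \<le> 10 * L" for s j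
  proof -
    have "snd (f (s + p)) (j - e s) = snd (f s) (j - e s)" using per by simp
    then show ?thesis using that calculation[of s] by (simp add: f_def algebra_simps)
  qed
  ultimately show ?thesis using p by blast
qed

text \<open>The deviation from the line of slope \<open>c / p\<close>, multiplied by
  \<open>p\<close> to stay in the integers, is \<open>p\<close>-periodic in \<open>s\<close>; it
  suffices to bound it over one period. There \<open>e\<close> and the line each contribute at most
  \<open>p * L\<close>.\<close>

lemma path_straight:
  assumes lip: "\<And>s. \<bar>e (s + 1) - e s\<bar> \<le> R" and p: "0 < p" "p \<le> K" "\<And>s. e (s + p) = e s + c"
  shows "\<bar>c\<bar> \<le> R * p" and "\<bar>p * e s - c * s - p * e 0\<bar> \<le> p * (2 * L)"
proof -
  show c: "\<bar>c\<bar> \<le> R * p"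
    using path_lipschitz[of e, OF lip, of p 0] p(1) p(3)[of 0] by simp
  define g where "g s = p * e s - c * s - p * e 0" for s
  have per: "g (s + p) = g s" for s
    using p(3)[of s] by (simp add: g_def algebra_simps)
  have "g s = g (s mod p)" by (rule periodic_mod[of g, OF per])
  also have "\<bar>g (s mod p)\<bar> \<le> p * (2 * L)"
  proof -
    let ?t = "s mod p"
    have t: "0 \<le> ?t" "?t \<le> p" using p by (simp_all add: less_imp_le)
    have Rt: "R * ?t \<le> 1 * L" "R * p \<le> 1 * L" by (rule R_mult_le; use t p in simp)+
    have "\<bar>e ?t - e 0\<bar> \<le> L"
      using path_lipschitz[of e, OF lip, of ?t 0] t Rt by simp
    then have 1: "\<bar>p * (e ?t - e 0)\<bar> \<le> p * L"
      using p(1) by (simp add: abs_mult mult_left_mono)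
    have "\<bar>c * ?t\<bar> \<le> L * p"
      unfolding abs_mult by (rule mult_mono) (use c t Rt L_ge(3) R in auto)
    then show ?thesis using 1 unfolding g_def by (simp add: algebra_simps)
  qed
  finally show "\<bar>p * e s - c * s - p * e 0\<bar> \<le> p * (2 * L)" by (simp add: g_def)
qed

text \<open>The strip has direction \<open>(p, c)\<close> and horizontal half-width
  \<open>4 * L\<close> around the level \<open>m\<close> of the linear form
  \<open>p * j - c * s\<close>. The period \<open>(a, b)\<close> is parallel to it, but may vary
  from strip to strip.\<close>

definition strip_periodic :: "int \<Rightarrow> int \<Rightarrow> int \<Rightarrow> bool"
  where "strip_periodic p c m \<longleftrightarrow> (\<exists>a b. 0 < a \<and> a \<le> K \<and> p * b = c * a \<and>
    (\<forall>s j. \<bar>p * j - c * s - m\<bar> \<le> p * (4 * L) \<longrightarrow> \<eta> (s + a) (j + b) = \<eta> s j))"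

lemma strip_periodic_path:
  assumes lip: "\<And>s. \<bar>e (s + 1) - e s\<bar> \<le> R" and p: "0 < p" "p \<le> K" "\<And>s. e (s + p) = e s + c"
    and per: "\<And>s j. \<bar>j - e s\<bar> \<le> 10 * L \<Longrightarrow> \<eta> (s + p) (j + c) = \<eta> s j"
  shows "strip_periodic p c (p * e 0)"
proof -
  have "\<eta> (s + p) (j + c) = \<eta> s j" if "\<bar>p * j - c * s - p * e 0\<bar> \<le> p * (4 * L)" for s j
  proof (rule per)
    have "\<bar>p * e s - c * s - p * e 0\<bar> \<le> p * (2 * L)"
      by (rule path_straight[of e, OF lip p])
    \<comment> \<open>The path is within \<open>2 * L\<close> of the line and the strip within
      \<open>4 * L\<close>.\<close>
    then have "\<bar>p * (j - e s)\<bar> \<le> p * (6 * L)"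
      using that by (simp add: algebra_simps)
    then have "\<bar>j - e s\<bar> \<le> 6 * L" using p(1) by (simp add: abs_mult)
    then show "\<bar>j - e s\<bar> \<le> 10 * L" using L_ge(3) by simp
  qed
  then show ?thesis unfolding strip_periodic_def using p by (intro exI[of _ p] exI[of _ c]) simp
qed

text \<open>In every block of rows the new strip gets a parallel period: the box period itself if it
  is parallel to the strip, otherwise the old period \<open>(a, b)\<close>, transported to the one
  new level. The one-dimensional criterion then produces a single period for the whole
  strip.\<close>

lemma strip_periodic_step:
  assumes p: "0 < p" "p \<le> K" and c: "\<bar>c\<bar> \<le> R * p" and \<delta>: "\<delta> = 1 \<or> \<delta> = - 1"
    and st: "strip_periodic p c m"
  shows "strip_periodic p c (m + \<delta>)"
proof -
  define l where "l s j = p * j - c * s" for s j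
  define P where "P = p * (4 * L)"
  \<comment> \<open>The content of row \<open>s\<close> inside the new strip, indexed by level.
    Parallel translations preserve levels, so equality of these sets expresses periodicity along the
    strip.\<close>
  define f where "f s = {(l s j, \<eta> s j) | j. \<bar>l s j - (m + \<delta>)\<bar> \<le> P}" for s
  have f_eq: "f (t + a) = f t \<longleftrightarrow> (\<forall>j. \<bar>l t j - (m + \<delta>)\<bar> \<le> P \<longrightarrow> \<eta> (t + a) (j + b) = \<eta> t j)"
    if ab: "p * b = c * a" for a b t
  proof -
    have inj: "l t i = l t j \<longleftrightarrow> i = j" for t i j using p by (simp add: l_def)
    have l: "l (t + a) j = l t (j - b)" for j using ab by (simp add: l_def algebra_simps)
    have f1: "f (t + a) = {(l t j, \<eta> (t + a) (j + b)) | j. \<bar>l t j - (m + \<delta>)\<bar> \<le> P}"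
      unfolding f_def l by (auto simp: set_eq_iff) (metis add_diff_cancel diff_add_cancel)+
    show ?thesis
    proof (intro iffI allI impI)
      fix j assume eq: "f (t + a) = f t" and j: "\<bar>l t j - (m + \<delta>)\<bar> \<le> P"
      have "(l t j, \<eta> (t + a) (j + b)) \<in> f (t + a)" unfolding f1 using j by blast
      then show "\<eta> (t + a) (j + b) = \<eta> t j" unfolding eq by (auto simp: f_def inj)
    next
      assume "\<forall>j. \<bar>l t j - (m + \<delta>)\<bar> \<le> P \<longrightarrow> \<eta> (t + a) (j + b) = \<eta> t j"
      then show "f (t + a) = f t" unfolding f1 unfolding f_def by (intro Collect_cong) metis
    qed
  qed
  obtain a b where ab: "0 < a" "a \<le> K" "p * b = c * a"
    and per: "\<And>s j. \<bar>l s j - m\<bar> \<le> P \<Longrightarrow> \<eta> (s + a) (j + b) = \<eta> s j"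
    using st by (auto simp: strip_periodic_def l_def P_def)
  have b_le: "\<bar>b\<bar> \<le> L"
  proof -
    have "p * \<bar>b\<bar> = \<bar>c\<bar> * a" using ab p by (metis abs_mult abs_of_pos)
    also have "\<dots> \<le> (R * p) * K" by (rule mult_mono) (use c ab p R in auto)
    finally have "p * \<bar>b\<bar> \<le> p * L" by (simp add: algebra_simps L_def)
    then show ?thesis using p by simp
  qed
  have loc: "\<exists>a b. 0 < a \<and> a \<le> K \<and> p * b = c * a \<and> (\<forall>t\<in>{s..s + 2 * K}. f (t + a) = f t)" for s
  proof -
    \<comment> \<open>A column in which row \<open>s\<close> meets the line of level
      \<open>m\<close>, up to rounding; the box is centred there.\<close>
    define i where "i = (m + c * s) div p"
    have i: "\<bar>l s i - m\<bar> \<le> p"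
    proof -
      have "p * i = m + c * s - (m + c * s) mod p"
        unfolding i_def by (simp add: minus_mod_eq_mult_div)
      moreover have "0 \<le> (m + c * s) mod p" "(m + c * s) mod p < p" using p by simp_all
      ultimately show ?thesis by (simp add: l_def)
    qed
    obtain a' b' where u: "0 \<le> a'" "a' \<le> K" "\<bar>b'\<bar> \<le> K" "a' = 0 \<Longrightarrow> b' \<noteq> 0"
      "\<And>t j. \<bar>t - s\<bar> \<le> 10 * K \<Longrightarrow> \<bar>j - i\<bar> \<le> 50 * L \<Longrightarrow> \<eta> (t + a') (j + b') = \<eta> t j"
      using box_period[of s i] by blast
    \<comment> \<open>In units of \<open>p * L\<close>: \<open>4\<close> for the strip,
      \<open>2\<close> for the drift over \<open>2 * K\<close> rows, and at most \<open>1\<close>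
      each for rounding and for \<open>\<delta>\<close>.\<close>
    have near: "\<bar>j - i\<bar> \<le> 8 * L" if "t \<in> {s..s + 2 * K}" "\<bar>l t j - (m + \<delta>)\<bar> \<le> P" for t j
    proof -
      have "\<bar>c * (t - s)\<bar> \<le> (R * p) * (2 * K)"
        unfolding abs_mult by (rule mult_mono) (use c that p R in auto)
      also have "\<dots> = 2 * (p * L)" by (simp add: L_def)
      finally have "\<bar>c * (t - s)\<bar> \<le> 2 * (p * L)" .
      moreover have "p * (j - i) = (l t j - (m + \<delta>)) - (l s i - m) + c * (t - s) + \<delta>"
        by (simp add: l_def algebra_simps)
      moreover have "p \<le> p * L" "1 \<le> p" using p L_ge(3) by simp_all
      ultimately have "\<bar>p * (j - i)\<bar> \<le> p * (8 * L)"
        using that(2) i \<delta> unfolding P_def mult.left_commute[of p] by linarith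
      then show ?thesis using p by (simp add: abs_mult)
    qed
    show ?thesis
    proof (cases "p * b' = c * a'")
      case True
      then have "0 < a'" using u p by (cases "a' = 0") auto
      moreover have "f (t + a') = f t" if "t \<in> {s..s + 2 * K}" for t
        unfolding f_eq[OF True] using u(5)[of t] near[OF that] that K L_ge(3) by fastforce
      ultimately show ?thesis using u True by blast
    next
      case False
      \<comment> \<open>The change of level caused by the box period. Being at most
        \<open>2 * P\<close> in size, a jump towards the old strip cannot overshoot it.\<close>
      define d where "d = p * b' - c * a'"
      have d: "d \<noteq> 0" "\<bar>d\<bar> \<le> 2 * P"
      proof -
        show "d \<noteq> 0" using False by (simp add: d_def)
        have "\<bar>c * a'\<bar> \<le> (R * p) * K" unfolding abs_mult by (rule mult_mono) (use c u p R in auto)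
        also have "\<dots> = p * L" by (simp add: L_def)
        finally have "\<bar>c * a'\<bar> \<le> p * L" .
        moreover have "\<bar>p * b'\<bar> \<le> p * L"
          unfolding abs_mult by (rule mult_mono) (use u p L_ge in auto)
        ultimately show "\<bar>d\<bar> \<le> 2 * P" unfolding d_def P_def mult.left_commute[of p] by linarith
      qed
      have "\<eta> (t + a) (j + b) = \<eta> t j"
        if t: "t \<in> {s..s + 2 * K}" and j: "\<bar>l t j - (m + \<delta>)\<bar> \<le> P" for t j
      proof (cases "\<bar>l t j - m\<bar> \<le> P")
        case True
        then show ?thesis by (rule per)
      next
        case False
        \<comment> \<open>The new strip contains only one level that the old one lacks.\<close>
        have lt: "l t j = m + \<delta> * (1 + P)" using j False \<delta> by auto
        have box: "\<eta> (t' + a') (j' + b') = \<eta> t' j'"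
          if "\<bar>t' - t\<bar> \<le> 2 * K" "\<bar>j' - j\<bar> \<le> 2 * L" for t' j'
          by (rule u(5)) (use that t near[OF t j] K L_ge(3) in auto)
        have RK: "0 < L" using L_ge(3) by simp
        show ?thesis
        \<comment> \<open>The sign decides whether adding or subtracting \<open>(a', b')\<close>
          leads into the old strip. There \<open>(a, b)\<close> is a period, and the box period
          brings the equality back.\<close>
        proof (cases "\<delta> * d < 0")
          case True
          have "\<bar>l (t + a') (j + b') - m\<bar> \<le> P"
          proof -
            have "l (t + a') (j + b') = l t j + d" by (simp add: l_def d_def algebra_simps)
            then show ?thesis using lt True d \<delta> by auto
          qed
          from per[OF this] have "\<eta> (t + a' + a) (j + b' + b) = \<eta> (t + a') (j + b')" .
          moreover have "\<eta> (t + a') (j + b') = \<eta> t j" by (rule box) (use K RK in auto)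
          moreover have "\<eta> (t + a + a') (j + b + b') = \<eta> (t + a) (j + b)"
            by (rule box) (use ab b_le RK K in auto)
          ultimately show ?thesis by (simp add: ac_simps)
        next
          case False
          have "\<bar>l (t - a') (j - b') - m\<bar> \<le> P"
          proof -
            have "l (t - a') (j - b') = l t j - d" by (simp add: l_def d_def algebra_simps)
            then show ?thesis using lt False d \<delta> by auto
          qed
          from per[OF this] have "\<eta> (t - a' + a) (j - b' + b) = \<eta> (t - a') (j - b')" .
          moreover have "\<eta> t j = \<eta> (t - a') (j - b')"
            using box[of "t - a'" "j - b'"] u L_ge K RK by simp
          moreover have "\<eta> (t + a) (j + b) = \<eta> (t - a' + a) (j - b' + b)"
            using box[of "t - a' + a" "j - b' + b"] u ab b_le L_ge K RK by (simp add: ac_simps abs_le_iff)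
          ultimately show ?thesis by simp
        qed
      qed
      then have "f (t + a) = f t" if "t \<in> {s..s + 2 * K}" for t
        unfolding f_eq[OF ab(3)] using that by blast
      then show ?thesis using ab by blast
    qed
  qed
  obtain a1 b1 where 1: "0 < a1" "a1 \<le> K" "p * b1 = c * a1" "\<forall>t\<in>{0..0 + 2 * K}. f (t + a1) = f t"
    using loc[of 0] by blast
  have "f (t + a1) = f t" for t
    by (rule periodic_if_locally_periodic[of K]) (use loc 1 in \<open>blast, auto\<close>)
  then show ?thesis
    unfolding strip_periodic_def f_eq[OF 1(3)] using 1 by (auto simp: l_def P_def)
qed

text \<open>Every point is on the central level of its own strip, and iterating the period of that
  strip stays on this level. All the heights divide the factorial of \<open>K\<close>.\<close>

lemma strip_periodic_global:
  assumes p: "0 < p" "p \<le> K" and c: "\<bar>c\<bar> \<le> R * p" and st: "\<And>m. strip_periodic p c m"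
  shows "\<exists>b. \<forall>s j. \<eta> (s + fact (nat K)) (j + b) = \<eta> s j"
proof -
  define F :: int where "F = fact (nat K)"
  have dvdF: "a dvd F" if "0 < a" "a \<le> K" for a
  proof -
    have "int (nat a) dvd int (fact (nat K))"
      unfolding int_dvd_int_iff by (rule dvd_fact) (use that in auto)
    then show ?thesis using that by (simp add: F_def)
  qed
  \<comment> \<open>The vector \<open>(F, c * k)\<close> is the only one of height \<open>F\<close>
    parallel to \<open>(p, c)\<close>; hence the different strips all yield the same
    translation.\<close>
  obtain k where k: "F = p * k" using dvdF[OF p] by (auto elim: dvdE)
  have Fpos: "0 < F" by (simp add: F_def)
  have "\<eta> (s + F) (j + c * k) = \<eta> s j" for s j
  proof -
    obtain a b where ab: "0 < a" "a \<le> K" "p * b = c * a"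
      and per: "\<And>t i. \<bar>p * i - c * t - (p * j - c * s)\<bar> \<le> p * (4 * L) \<Longrightarrow> \<eta> (t + a) (i + b) = \<eta> t i"
      using st[of "p * j - c * s"] by (auto simp: strip_periodic_def)
    have *: "\<eta> (s + a * int n) (j + b * int n) = \<eta> s j" for n
    proof (induction n)
      case (Suc n)
      have "p * (j + b * int n) - c * (s + a * int n) = p * j - c * s + (p * b - c * a) * int n"
        by (simp add: algebra_simps)
      then have "\<eta> (s + a * int n + a) (j + b * int n + b) = \<eta> (s + a * int n) (j + b * int n)"
        by (intro per) (use ab p L_ge(3) in simp)
      then show ?case using Suc by (simp add: algebra_simps)
    qed simp
    obtain h where h: "F = a * h" using dvdF[OF ab(1,2)] by (auto elim: dvdE)
    then have "0 < h" using Fpos ab(1) by (simp add: zero_less_mult_iff)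
    have "p * (b * h) = p * (c * k)"
      using ab(3) h k by (metis mult.assoc mult.left_commute)
    then have "b * h = c * k" using p by simp
    then show ?thesis using *[of "nat h"] \<open>0 < h\<close> h by simp
  qed
  then show ?thesis unfolding F_def by blast
qed

text \<open>The first disagreement to the right starts a boundary path; the strip around it spreads
  level by level in both directions until it covers the plane.\<close>

lemma periodic_if_right_dis:
  assumes v: "\<bar>a0\<bar> \<le> K" "\<bar>b0\<bar> \<le> K"
    and ag: "\<And>j. \<bar>j\<bar> \<le> 100 * L \<Longrightarrow> \<not> dis a0 b0 0 j"
    and i: "0 \<le> i" "dis a0 b0 0 i"
  shows "\<exists>b. \<forall>s j. \<eta> (s + fact (nat K)) (j + b) = \<eta> s j"
proof -
  obtain j0 where j0: "0 \<le> j0" "dis a0 b0 0 j0" "\<And>k. 0 \<le> k \<Longrightarrow> k < j0 \<Longrightarrow> \<not> dis a0 b0 0 k"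
    using first_dis[OF i(2,1)] by blast
  have "bdry a0 b0 (100 * L) 0 j0"
    unfolding bdry_def
  proof (intro conjI allI impI)
    fix k assume k: "j0 - 100 * L \<le> k" "k < j0"
    show "\<not> dis a0 b0 0 k"
      using ag[of k] j0(1) j0(3)[of k] k by (cases "0 \<le> k") auto
  qed (rule j0(2))
  then obtain e where e: "\<And>s. bdry a0 b0 (20 * L) s (e s)" "\<And>s. \<bar>e (s + 1) - e s\<bar> \<le> R"
    using bdry_path[OF v] by blast
  obtain p c where pc: "0 < p" "p \<le> K" "\<And>s. e (s + p) = e s + c"
    "\<And>s j. \<bar>j - e s\<bar> \<le> 10 * L \<Longrightarrow> \<eta> (s + p) (j + c) = \<eta> s j"
    using path_period[of a0 b0 e, OF v e] by blast
  have c: "\<bar>c\<bar> \<le> R * p" by (rule path_straight(1)[of e, OF e(2) pc(1-3)])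
  have "strip_periodic p c m" for m
  proof (induction m rule: int_induct[of _ "p * e 0"])
    case base
    show ?case by (rule strip_periodic_path[of e, OF e(2) pc])
  next
    case (step1 i)
    then show ?case using strip_periodic_step[OF pc(1,2) c, of 1 i] by simp
  next
    case (step2 i)
    then show ?case using strip_periodic_step[OF pc(1,2) c, of "- 1" i] by simp
  qed
  then show ?thesis by (rule strip_periodic_global[OF pc(1,2) c])
qed

text \<open>A local period at the origin is global, fails to the right, or fails to the left, which
  is the mirror image. A horizontal global period is kept apart because it gives no return of a row
  by itself.\<close>

lemma globally_periodic:
  "(\<exists>b. b \<noteq> 0 \<and> \<bar>b\<bar> \<le> K \<and> (\<forall>s j. \<eta> s (j + b) = \<eta> s j)) \<or>
   (\<exists>a b. 0 < a \<and> a \<le> max K (fact (nat K)) \<and> (\<forall>s j. \<eta> (s + a) (j + b) = \<eta> s j))"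
proof -
  obtain a0 b0 where v: "(a0, b0) \<noteq> (0, 0)" "\<bar>a0\<bar> \<le> K" "\<bar>b0\<bar> \<le> K"
    and per: "\<And>j. \<bar>j\<bar> \<le> 100 * L \<Longrightarrow> \<eta> 0 j = \<eta> (0 + a0) (j + b0)"
    using local_period[of 0 0] unfolding L_def by auto
  have ag: "\<not> dis a0 b0 0 j" if "\<bar>j\<bar> \<le> 100 * L" for j
    using per[OF that] by (simp add: dis_def)
  have fin: ?thesis if "\<exists>b. \<forall>s j. \<eta> (s + fact (nat K)) (j + b) = \<eta> s j"
  proof -
    have "(0::int) < fact (nat K) \<and> (fact (nat K) :: int) \<le> max K (fact (nat K))" by simp
    then show ?thesis using that by blast
  qed
  consider (right) i where "0 \<le> i" "dis a0 b0 0 i" | (left) i where "i \<le> 0" "dis a0 b0 0 i"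
    | (global) "\<And>i. \<not> dis a0 b0 0 i"
    by (meson linear)
  then show ?thesis
  proof cases
    case right
    then have "\<exists>b. \<forall>s j. \<eta> (s + fact (nat K)) (j + b) = \<eta> s j"
      using periodic_if_right_dis[OF v(2,3) ag] by blast
    then show ?thesis by (rule fin)
  next
    case left
    interpret M: locally_periodic_plane "\<lambda>s j. \<eta> s (- j)" R K by (rule locally_periodic_mirror)
    have mir: "M.dis a0 (- b0) s j \<longleftrightarrow> dis a0 b0 s (- j)" for s j
      by (simp add: M.dis_def dis_def add.commute)
    have "\<exists>b. \<forall>s j. \<eta> (s + fact (nat K)) (- (j + b)) = \<eta> s (- j)"
      by (rule M.periodic_if_right_dis[of a0 "- b0" "- i"]) (use v ag left in \<open>auto simp: mir\<close>)
    then obtain b where b: "\<And>s j. \<eta> (s + fact (nat K)) (- (j + b)) = \<eta> s (- j)" by blast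
    have "\<eta> (s + fact (nat K)) (j + - b) = \<eta> s j" for s j
      using b[of s "- j"] by simp
    then have "\<exists>b. \<forall>s j. \<eta> (s + fact (nat K)) (j + b) = \<eta> s j" by blast
    then show ?thesis by (rule fin)
  next
    case global
    have per: "\<eta> s j = \<eta> (s + a0) (j + b0)" for s j
      by (rule row_period_global[of 0]) (use global in \<open>simp add: dis_def\<close>)
    consider "a0 = 0" | "a0 > 0" | "a0 < 0" by linarith
    then show ?thesis
    proof cases
      case 1
      then show ?thesis using v per by (intro disjI1 exI[of _ b0]) auto
    next
      case 2
      then show ?thesis using v per by (intro disjI2 exI[of _ a0] exI[of _ b0]) auto
    next
      case 3
      have "\<eta> (s + - a0) (j + - b0) = \<eta> s j" for s j
        using per[of "s - a0" "j - b0"] by simp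
      then show ?thesis using 3 v by (intro disjI2 exI[of _ "- a0"] exI[of _ "- b0"]) auto
    qed
  qed
qed

end

section \<open>Automorphisms of subshifts\<close>

definition shift_by :: "int \<Rightarrow> (int \<Rightarrow> 'a) \<Rightarrow> int \<Rightarrow> 'a"
  where "shift_by b x = (\<lambda>i. x (i + b))"

lemma shift_by_0 [simp]: "shift_by 0 x = x"
  and shift_by_1: "shift_by 1 = shift"
  and shift_by_add: "shift_by a (shift_by b x) = shift_by (a + b) x"
  by (auto simp: shift_by_def shift_def fun_eq_iff add.assoc)

lemma shift_by_closed:
  assumes X: "subshift A X" and x: "x \<in> X"
  shows "shift_by b x \<in> X"
proof -
  have sX: "shift ` X = X" using X by (simp add: subshift_def)
  have up: "shift_by (int n) x \<in> X" for n
  proof (induction n)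
    case (Suc n)
    then have "shift (shift_by (int n) x) \<in> X" using sX by blast
    then show ?case by (simp add: shift_by_1[symmetric] shift_by_add)
  qed (simp add: x)
  have down: "shift_by (- int n) x \<in> X" for n
  proof (induction n)
    case (Suc n)
    then obtain y where y: "y \<in> X" "shift_by (- int n) x = shift y" using sX by blast
    then have "shift_by (- 1) (shift_by (- int n) x) = y"
      by (simp add: shift_by_1[symmetric] shift_by_add)
    then show ?case using y(1) by (simp add: shift_by_add)
  qed (simp add: x)
  show ?thesis using up[of "nat b"] down[of "nat (- b)"] by (cases "0 \<le> b") simp_all
qed

lemma shift_aut_shift_by:
  assumes X: "subshift A X" and f: "f \<in> shift_aut A X" and x: "x \<in> X"
  shows "f (shift_by b x) = shift_by b (f x)"
proof -
  have comm: "f (shift_by 1 y) = shift_by 1 (f y)" if "y \<in> X" for y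
    using f that by (simp add: shift_aut_def shift_by_1)
  note cl = shift_by_closed[OF X]
  have up: "f (shift_by (int n) y) = shift_by (int n) (f y)" if "y \<in> X" for n y
  proof (induction n)
    case (Suc n)
    have "f (shift_by 1 (shift_by (int n) y)) = shift_by 1 (shift_by (int n) (f y))"
      using comm[OF cl[OF that]] Suc by simp
    then show ?case by (simp add: shift_by_add)
  qed simp
  show ?thesis
  proof (cases "0 \<le> b")
    case True
    then show ?thesis using up[OF x, of "nat b"] by simp
  next
    case False
    have "f x = shift_by (- b) (f (shift_by b x))"
      using up[OF cl[OF x, of b], of "nat (- b)"] False by (simp add: shift_by_add)
    then show ?thesis by (simp add: shift_by_add)
  qed
qed

section \<open>Cylinders and locality of automorphisms\<close>

definition cylinder :: "(int \<Rightarrow> 'a) set \<Rightarrow> int \<Rightarrow> (int \<Rightarrow> 'a) \<Rightarrow> (int \<Rightarrow> 'a) set"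
  where "cylinder X r x = {y \<in> X. \<forall>i. \<bar>i\<bar> \<le> r \<longrightarrow> y i = x i}"

lemma openin_cylinder:
  assumes "x \<in> X" "X \<subseteq> topspace (full_shift A)"
  shows "openin (subtopology (full_shift A) X) (cylinder X r x)"
proof -
  let ?U = "\<lambda>i. if \<bar>i\<bar> \<le> r then {x i} else A"
  have xA: "x i \<in> A" for i using assms unfolding topspace_full_shift by blast
  have "finite {i. \<bar>i\<bar> \<le> r}"
    by (rule finite_subset[of _ "{- r..r}"]) auto
  then have "finite {i \<in> UNIV. ?U i \<noteq> topspace (discrete_topology A)}"
    by (rule rev_finite_subset) auto
  then have "openin (full_shift A) (PiE UNIV ?U)"
    unfolding full_shift_def openin_PiE_gen using xA by auto
  moreover have "cylinder X r x = PiE UNIV ?U \<inter> X"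
  proof -
    have "y i \<in> A" if "y \<in> X" for y i using assms(2) that unfolding topspace_full_shift by blast
    then show ?thesis by (auto simp: cylinder_def PiE_UNIV_domain Pi_iff split: if_splits)
  qed
  ultimately show ?thesis unfolding openin_subtopology by blast
qed

lemma openin_contains_cylinder:
  assumes "openin (subtopology (full_shift A) X) W" "x \<in> W" "X \<subseteq> topspace (full_shift A)"
  shows "\<exists>r. cylinder X r x \<subseteq> W"
proof -
  obtain S where S: "openin (full_shift A) S" "W = S \<inter> X"
    using assms(1) unfolding openin_subtopology by blast
  then obtain U where U: "finite {i. U i \<noteq> A}" "x \<in> PiE UNIV U" "PiE UNIV U \<subseteq> S"
    using assms(2) unfolding full_shift_def openin_product_topology_alt by auto
  define r where "r = Max (insert 0 (abs ` {i. U i \<noteq> A}))"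
  have r: "\<bar>i\<bar> \<le> r" if "U i \<noteq> A" for i
    unfolding r_def by (rule Max_ge) (use U that in auto)
  have "y \<in> W" if y: "y \<in> X" "\<forall>i. \<bar>i\<bar> \<le> r \<longrightarrow> y i = x i" for y
  proof -
    have "y i \<in> U i" for i
    proof (cases "U i = A")
      case True
      then show ?thesis using y(1) assms(3) unfolding topspace_full_shift by blast
    next
      case False
      then show ?thesis using y(2) r U(2) by (auto simp: PiE_UNIV_domain Pi_iff)
    qed
    then show ?thesis using U(3) S y(1) by (auto simp: PiE_UNIV_domain Pi_iff)
  qed
  then show ?thesis unfolding cylinder_def by blast
qed

lemma compact_space_subshift:
  assumes "finite A" "subshift A X"
  shows "compact_space (subtopology (full_shift A) X)"
proof -
  have "compact_space (full_shift A)"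
    unfolding full_shift_def using assms(1)
    by (simp add: compact_space_product_topology compact_space_discrete_topology)
  then show ?thesis
    using assms(2) by (meson closedin_compact_space compact_space_subtopology subshift_def)
qed

text \<open>Continuity makes \<open>f y 0\<close> constant on a cylinder around each point, and
  compactness leaves finitely many cylinders, hence a common radius. Commutation with the shift
  moves the statement from \<open>0\<close> to any position.\<close>

lemma curtis_hedlund_lyndon:
  assumes A: "finite A" and X: "subshift A X" and f: "f \<in> shift_aut A X"
  obtains R where "0 \<le> R"
    "\<And>x y i. x \<in> X \<Longrightarrow> y \<in> X \<Longrightarrow> (\<And>j. \<bar>j - i\<bar> \<le> R \<Longrightarrow> x j = y j) \<Longrightarrow> f x i = f y i"
proof -
  let ?T = "subtopology (full_shift A) X"
  have sub: "X \<subseteq> topspace (full_shift A)" by (rule subshift_subset[OF X])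
  then have top: "topspace ?T = X" by auto
  have cont: "continuous_map ?T ?T f"
    using f by (auto simp: shift_aut_def homeomorphic_eq_everything_map)
  have fX: "f x \<in> X" if "x \<in> X" for x
    using cont that top by (auto simp: continuous_map_def)
  have "\<forall>x\<in>X. \<exists>r. \<forall>y\<in>cylinder X r x. f y 0 = f x 0"
  proof
    fix x assume x: "x \<in> X"
    have "openin ?T {y \<in> topspace ?T. f y \<in> cylinder X 0 (f x)}"
      by (rule openin_continuous_map_preimage[OF cont openin_cylinder[OF fX[OF x] sub]])
    moreover have "x \<in> {y \<in> topspace ?T. f y \<in> cylinder X 0 (f x)}"
      using x fX[OF x] unfolding top by (simp add: cylinder_def)
    ultimately obtain r where "cylinder X r x \<subseteq> {y \<in> topspace ?T. f y \<in> cylinder X 0 (f x)}"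
      using openin_contains_cylinder sub by blast
    then show "\<exists>r. \<forall>y\<in>cylinder X r x. f y 0 = f x 0"
      by (intro exI[of _ r]) (auto simp: cylinder_def)
  qed
  then obtain r where r: "\<And>x y. x \<in> X \<Longrightarrow> y \<in> cylinder X (r x) x \<Longrightarrow> f y 0 = f x 0"
    using bchoice[of X "\<lambda>x r. \<forall>y\<in>cylinder X r x. f y 0 = f x 0"] by blast
  have mem: "x \<in> cylinder X (r x) x" if "x \<in> X" for x using that by (simp add: cylinder_def)
  have op: "openin ?T U" if "U \<in> (\<lambda>x. cylinder X (r x) x) ` X" for U
    using that openin_cylinder[OF _ sub] by blast
  have "topspace ?T \<subseteq> \<Union> ((\<lambda>x. cylinder X (r x) x) ` X)" using mem top by blast
  then obtain F where F: "finite F" "F \<subseteq> (\<lambda>x. cylinder X (r x) x) ` X" "topspace ?T \<subseteq> \<Union> F"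
    using compact_space_subshift[OF A X] op unfolding compact_space_alt by meson
  obtain Y where Y: "finite Y" "Y \<subseteq> X" "X \<subseteq> (\<Union>x\<in>Y. cylinder X (r x) x)"
    using finite_subset_image[OF F(1,2)] F(3) unfolding top by blast
  define R where "R = Max (insert 0 (r ` Y))"
  have R: "0 \<le> R" "\<And>x. x \<in> Y \<Longrightarrow> r x \<le> R"
    unfolding R_def by (rule Max_ge; use Y in simp)+
  have R0: "f x 0 = f y 0" if xy: "x \<in> X" "y \<in> X" "\<And>j. \<bar>j\<bar> \<le> R \<Longrightarrow> x j = y j" for x y
  proof -
    obtain z where z: "z \<in> Y" "x \<in> cylinder X (r z) z" using Y(3) xy(1) by blast
    have "y i = z i" if "\<bar>i\<bar> \<le> r z" for i
    proof -
      have "\<bar>i\<bar> \<le> R" using that R(2)[OF z(1)] by linarith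
      then show ?thesis using xy(3)[of i] z(2) that by (simp add: cylinder_def)
    qed
    then have "y \<in> cylinder X (r z) z" using xy(2) by (simp add: cylinder_def)
    then show ?thesis using r[of z x] r[of z y] z Y(2) by auto
  qed
  show ?thesis
  proof (rule that[OF R(1)])
    fix x y i assume xy: "x \<in> X" "y \<in> X" "\<And>j. \<bar>j - i\<bar> \<le> R \<Longrightarrow> x j = y j"
    have "f (shift_by i x) 0 = f (shift_by i y) 0"
      by (rule R0) (use xy shift_by_closed[OF X] in \<open>auto simp: shift_by_def\<close>)
    then show "f x i = f y i"
      using xy shift_aut_shift_by[OF X f] by (simp add: shift_by_def)
  qed
qed

section \<open>Two-sided orbits as plane configurations\<close>

lemma shift_aut_inverse:
  assumes X: "subshift A X" and f: "f \<in> shift_aut A X"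
  obtains g where "g \<in> shift_aut A X" "\<And>x. x \<in> X \<Longrightarrow> g (f x) = x" "\<And>x. x \<in> X \<Longrightarrow> f (g x) = x"
proof -
  interpret G: group "Aut_shift A X" by (rule group_Aut_shift[OF X])
  have carrier: "carrier (Aut_shift A X) = shift_aut A X" by (simp add: Aut_shift_def)
  let ?g = "inv\<^bsub>Aut_shift A X\<^esub> f"
  have g: "?g \<in> shift_aut A X" using G.inv_closed f carrier by blast
  have "?g \<otimes>\<^bsub>Aut_shift A X\<^esub> f = \<one>\<^bsub>Aut_shift A X\<^esub>" "f \<otimes>\<^bsub>Aut_shift A X\<^esub> ?g = \<one>\<^bsub>Aut_shift A X\<^esub>"
    using f carrier by auto
  then have "compose X ?g f = (\<lambda>x\<in>X. x)" "compose X f ?g = (\<lambda>x\<in>X. x)"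
    using f g shift_aut_subset_Bij[OF X] by (auto simp: Aut_shift_def BijGroup_def subset_iff)
  then have "?g (f x) = x" "f (?g x) = x" if "x \<in> X" for x
    using that by (metis compose_eq restrict_apply')+
  then show ?thesis using that g by blast
qed

lemma shift_aut_closed:
  assumes "subshift A X" "f \<in> shift_aut A X" "x \<in> X"
  shows "f x \<in> X" "(f ^^ n) x \<in> X"
proof -
  have *: "f y \<in> X" if "y \<in> X" for y
    using shift_aut_subset_Bij[OF assms(1)] assms(2) that by (auto simp: Bij_def bij_betw_def)
  show "f x \<in> X" using * assms(3) .
  show "(f ^^ n) x \<in> X" by (induction n) (use * assms(3) in auto)
qed

lemma shift_aut_orbit:
  assumes X: "subshift A X" and f: "f \<in> shift_aut A X" and g: "g \<in> shift_aut A X"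
    and gf: "\<And>x. x \<in> X \<Longrightarrow> g (f x) = x" "\<And>x. x \<in> X \<Longrightarrow> f (g x) = x" and x: "x \<in> X"
  obtains \<eta> :: "int \<Rightarrow> int \<Rightarrow> 'a" where "\<And>n. \<eta> (int n) = (f ^^ n) x" "\<And>s. \<eta> s \<in> X"
    "\<And>s. \<eta> (s + 1) = f (\<eta> s)" "\<And>s. \<eta> (s - 1) = g (\<eta> s)"
proof -
  define \<eta> where "\<eta> s = (if 0 \<le> s then (f ^^ nat s) x else (g ^^ nat (- s)) x)" for s
  have \<eta>X: "\<eta> s \<in> X" for s
    using shift_aut_closed[OF X f x] shift_aut_closed[OF X g x] by (simp add: \<eta>_def)
  have step: "\<eta> (s + 1) = f (\<eta> s)" for s
  proof (cases "0 \<le> s")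
    case True
    then show ?thesis by (simp add: \<eta>_def nat_add_distrib)
  next
    case False
    then have n: "nat (- s) = Suc (nat (- (s + 1)))" by simp
    have "f (\<eta> s) = (g ^^ nat (- (s + 1))) x"
      using False gf(2) shift_aut_closed(2)[OF X g x] unfolding \<eta>_def n by simp
    then show ?thesis using False by (cases "s = - 1") (simp_all add: \<eta>_def)
  qed
  show ?thesis
  proof (rule that[of \<eta>])
    show "\<eta> (s - 1) = g (\<eta> s)" for s
      using step[of "s - 1"] gf(1)[OF \<eta>X] by simp
  qed (use \<eta>X step in \<open>simp_all add: \<eta>_def\<close>)
qed

lemma ca_plane_shift_aut_orbit:
  assumes X: "subshift A X" and f: "f \<in> shift_aut A X" and g: "g \<in> shift_aut A X" and R: "1 \<le> R"
    and Rf: "\<And>x y i. x \<in> X \<Longrightarrow> y \<in> X \<Longrightarrow> (\<And>j. \<bar>j - i\<bar> \<le> R \<Longrightarrow> x j = y j) \<Longrightarrow> f x i = f y i"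
    and Rg: "\<And>x y i. x \<in> X \<Longrightarrow> y \<in> X \<Longrightarrow> (\<And>j. \<bar>j - i\<bar> \<le> R \<Longrightarrow> x j = y j) \<Longrightarrow> g x i = g y i"
    and \<eta>: "\<And>s. \<eta> s \<in> X" "\<And>s. \<eta> (s + 1) = f (\<eta> s)" "\<And>s. \<eta> (s - 1) = g (\<eta> s)"
  shows "ca_plane \<eta> R"
proof
  fix s a b l h j
  assume ag: "\<And>j. l \<le> j \<Longrightarrow> j \<le> h \<Longrightarrow> \<eta> s j = \<eta> (s + a) (j + b)" and j: "l + R \<le> j" "j \<le> h - R"
  have loc: "\<eta> s k = shift_by b (\<eta> (s + a)) k" if "\<bar>k - j\<bar> \<le> R" for k
    using ag[of k] j that by (simp add: shift_by_def)
  \<comment> \<open>The translated row is again a point of \<open>X\<close>, so the local rules of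
    \<open>f\<close> and \<open>g\<close> apply to both rows.\<close>
  have cl: "shift_by b (\<eta> (s + a)) \<in> X" using shift_by_closed[OF X] \<eta>(1) by blast
  have "f (\<eta> s) j = shift_by b (f (\<eta> (s + a))) j"
    using Rf[OF \<eta>(1) cl loc] shift_aut_shift_by[OF X f \<eta>(1)] by simp
  then show "\<eta> (s + 1) j = \<eta> (s + 1 + a) (j + b)"
    using \<eta>(2)[of s] \<eta>(2)[of "s + a"] by (simp add: shift_by_def ac_simps)
  have "g (\<eta> s) j = shift_by b (g (\<eta> (s + a))) j"
    using Rg[OF \<eta>(1) cl loc] shift_aut_shift_by[OF X g \<eta>(1)] by simp
  moreover have eq: "s - 1 + a = s + a - 1" by simp
  ultimately show "\<eta> (s - 1) j = \<eta> (s - 1 + a) (j + b)"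
    unfolding eq \<eta>(3) by (simp add: shift_by_def)
qed (rule R)

text \<open>Reading words of length \<open>n\<close> at \<open>K\<close> consecutive rows and
  \<open>K\<close> consecutive offsets gives \<open>K ^ 2\<close> readings but fewer words. The
  difference of two places with equal words is a nonzero period on a long interval of some row
  \<open>s + t\<close>, and \<open>cone\<close> brings it back to row \<open>s\<close>.\<close>

lemma locally_periodic_if_low_complexity:
  assumes A: "finite A" and X: "subshift A X" and ca: "ca_plane \<eta> R" and \<eta>: "\<And>s. \<eta> s \<in> X"
    and K: "1 \<le> K" and n: "210 * R * int K \<le> int n" and P: "complexity X n < K ^ 2"
  shows "locally_periodic_plane \<eta> R (int K)"
proof -
  interpret ca_plane \<eta> R by (rule ca)
  define L where "L = R * int K"
  have "1 * int K \<le> R * int K" using R by (intro mult_mono) auto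
  then have KL: "int K \<le> L" by (simp add: L_def)
  show ?thesis
  proof
    fix s i
    \<comment> \<open>Starting at \<open>i - 104 * L\<close> leaves room on the left for the offset,
      less than \<open>K \<le> L\<close>, and for the cone, at most \<open>L\<close>; the length
      \<open>210 * L\<close> covers the right side.\<close>
    define w where "w = (\<lambda>(t, k). map (\<lambda>m. \<eta> (s + int t) (i - 104 * L + int k + int m)) [0..<n])"
    have "w ` ({..<K} \<times> {..<K}) \<subseteq> language X n"
    proof (clarsimp simp: w_def language_def)
      fix t k
      show "\<exists>x\<in>X. \<forall>m<n. x (int m) = \<eta> (s + int t) (i - 104 * L + int k + int m)"
        by (rule bexI[OF _ shift_by_closed[OF X \<eta>[of "s + int t"], of "i - 104 * L + int k"]])
          (simp add: shift_by_def ac_simps)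
    qed
    from card_mono[OF finite_language[OF A X] this]
    have "card (w ` ({..<K} \<times> {..<K})) < card ({..<K} \<times> {..<K})"
      using P by (simp add: complexity_def power2_eq_square)
    then have "\<not> inj_on w ({..<K} \<times> {..<K})" by (rule pigeonhole)
    then obtain p p' where p: "p \<in> {..<K} \<times> {..<K}" "p' \<in> {..<K} \<times> {..<K}" "p \<noteq> p'" "w p = w p'"
      unfolding inj_on_def by blast
    obtain t k t' k' where pp: "p = (t, k)" "p' = (t', k')" by (cases p, cases p') blast
    then have tk: "t < K" "k < K" "t' < K" "k' < K" "(t, k) \<noteq> (t', k')"
      and eq: "w (t, k) = w (t', k')"
      using p by simp_all
    define a b where "a = int t' - int t" and "b = int k' - int k"
    have row: "\<eta> (s + int t) j = \<eta> (s + int t + a) (j + b)"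
      if "i - 104 * L + int k \<le> j" "j \<le> i - 104 * L + int k + int n - 1" for j
    proof -
      define m where "m = nat (j - (i - 104 * L + int k))"
      have m: "m < n" "j = i - 104 * L + int k + int m" using that by (auto simp: m_def)
      have "w (t, k) ! m = w (t', k') ! m" using eq by simp
      then have "\<eta> (s + int t) (i - 104 * L + int k + int m) = \<eta> (s + int t') (i - 104 * L + int k' + int m)"
        using m(1) by (simp add: w_def)
      moreover have "s + int t + a = s + int t'" "j + b = i - 104 * L + int k' + int m"
        using m(2) by (simp_all add: a_def b_def)
      ultimately show ?thesis using m(2) by (simp only:)
    qed
    have nL: "210 * L \<le> int n" using n by (simp add: L_def mult.assoc)
    have Rt: "R * int t \<le> L" unfolding L_def by (rule mult_left_mono) (use tk R in auto)
    have "\<eta> s j = \<eta> (s + a) (j + b)" if "\<bar>j - i\<bar> \<le> 100 * L" for j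
    proof (rule cone[of "i - 104 * L + int k" "i - 104 * L + int k + int n - 1" "s + int t"])
      have t: "\<bar>s - (s + int t)\<bar> = int t" by simp
      show "i - 104 * L + int k + R * \<bar>s - (s + int t)\<bar> \<le> j"
        "j \<le> i - 104 * L + int k + int n - 1 - R * \<bar>s - (s + int t)\<bar>"
        unfolding t using that Rt KL tk nL K by linarith+
    qed (use row in simp)
    moreover have "(a, b) \<noteq> (0, 0)" "\<bar>a\<bar> \<le> int K" "\<bar>b\<bar> \<le> int K"
      using tk by (auto simp: a_def b_def)
    ultimately show "\<exists>a b. (a, b) \<noteq> (0, 0) \<and> \<bar>a\<bar> \<le> int K \<and> \<bar>b\<bar> \<le> int K \<and>
      (\<forall>j. \<bar>j - i\<bar> \<le> 100 * (R * int K) \<longrightarrow> \<eta> s j = \<eta> (s + a) (j + b))"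
      unfolding L_def by blast
  qed (use K in simp)
qed

lemma exists_low_complexity:
  assumes "liminf (\<lambda>n. ereal (real (complexity X n) / (real n)\<^sup>2)) = 0" and D: "0 < D"
  obtains n K where "1 \<le> K" "D * K \<le> n" "complexity X n < K ^ 2"
proof -
  let ?u = "\<lambda>n. real (complexity X n) / (real n)\<^sup>2"
  \<comment> \<open>The factor \<open>2\<close> pays for rounding in \<open>n div D\<close>: since
    \<open>n < 2 * D * K\<close>, the bound becomes \<open>K ^ 2\<close>.\<close>
  have "\<exists>n\<ge>D. ?u n < 1 / (2 * real D)\<^sup>2"
  proof (rule ccontr)
    assume "\<not> ?thesis"
    then have "eventually (\<lambda>n. ereal (1 / (2 * real D)\<^sup>2) \<le> ereal (?u n)) sequentially"
      unfolding eventually_sequentially by (intro exI[of _ D]) (auto simp: not_less)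
    then have "ereal (1 / (2 * real D)\<^sup>2) \<le> liminf (\<lambda>n. ereal (?u n))" by (rule Liminf_bounded)
    then show False using assms by simp
  qed
  then obtain n where n: "D \<le> n" "?u n < 1 / (2 * real D)\<^sup>2" by blast
  define K where "K = n div D"
  have K: "1 \<le> K" "D * K \<le> n" using n(1) D by (simp_all add: K_def Suc_le_eq div_greater_zero_iff)
  have "n < D * (K + 1)" unfolding K_def using D by (simp add: dividend_less_times_div algebra_simps)
  also have "\<dots> \<le> D * (2 * K)" using K by simp
  finally have nK: "real n \<le> 2 * real D * real K"
    by (metis less_imp_le mult.assoc mult.left_commute of_nat_le_iff of_nat_mult of_nat_numeral)
  have "real (complexity X n) < (real n)\<^sup>2 / (2 * real D)\<^sup>2"
    using n D by (simp add: field_simps)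
  also have "\<dots> \<le> (2 * real D * real K)\<^sup>2 / (2 * real D)\<^sup>2"
    by (intro divide_right_mono power_mono) (use nK in auto)
  also have "\<dots> = (real K)\<^sup>2" using D by (simp add: power_mult_distrib)
  finally have "complexity X n < K ^ 2" by (metis of_nat_less_iff of_nat_power)
  then show ?thesis using that K by blast
qed

section \<open>Powers that act on each point as a shift\<close>

lemma funpow_shift_aut_shift_by:
  assumes X: "subshift A X" and f: "f \<in> shift_aut A X" and x: "x \<in> X"
  shows "(f ^^ k) (shift_by b x) = shift_by b ((f ^^ k) x)"
proof (induction k)
  case (Suc k)
  then show ?case using shift_aut_shift_by[OF X f shift_aut_closed(2)[OF X f x]] by simp
qed simp

lemma funpow_eq_shift_by:
  assumes X: "subshift A X" and f: "f \<in> shift_aut A X" and x: "x \<in> X"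
    and eq: "(f ^^ a) x = shift_by b x"
  shows "(f ^^ (a * m)) x = shift_by (b * int m) x"
proof (induction m)
  case (Suc m)
  have "(f ^^ (a * Suc m)) x = (f ^^ a) ((f ^^ (a * m)) x)"
    by (simp add: funpow_add)
  also have "\<dots> = shift_by (b * int (Suc m)) x"
    using Suc funpow_shift_aut_shift_by[OF X f x] eq by (simp add: shift_by_add algebra_simps)
  finally show ?case .
qed simp

lemma eq_if_same_period:
  fixes x y :: "int \<Rightarrow> 'a"
  assumes b: "0 < b" "b \<le> int K" and x: "\<And>j. x (j + b) = x j" and y: "\<And>j. y (j + b) = y j"
    and eq: "map (\<lambda>k. x (int k)) [0..<K] = map (\<lambda>k. y (int k)) [0..<K]"
  shows "x = y"
proof
  fix j
  have m: "0 \<le> j mod b" "j mod b < b" using b by simp_all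
  then have k: "nat (j mod b) < K" using b by linarith
  have "map (\<lambda>k. x (int k)) [0..<K] ! nat (j mod b) = map (\<lambda>k. y (int k)) [0..<K] ! nat (j mod b)"
    by (simp only: eq)
  then have "x (j mod b) = y (j mod b)" using k m by simp
  then show "x j = y j" using periodic_mod[of x b j, OF x] periodic_mod[of y b j, OF y] by simp
qed

text \<open>The exponent must not depend on \<open>x\<close>. The exponents found for single points
  are at most \<open>M\<close>, so \<open>fact M\<close> is a multiple of each.\<close>

lemma funpow_eq_shift_by_exists:
  assumes A: "finite A" and X: "subshift A X" and f: "f \<in> shift_aut A X"
    and liminf: "liminf (\<lambda>n. ereal (real (complexity X n) / (real n)\<^sup>2)) = 0"
  obtains N where "0 < N" "\<And>x. x \<in> X \<Longrightarrow> \<exists>b. (f ^^ N) x = shift_by b x"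
proof -
  obtain g where g: "g \<in> shift_aut A X"
    and gf: "\<And>x. x \<in> X \<Longrightarrow> g (f x) = x" "\<And>x. x \<in> X \<Longrightarrow> f (g x) = x"
    using shift_aut_inverse[OF X f] by blast
  obtain R1 where R1: "0 \<le> R1"
    "\<And>x y i. x \<in> X \<Longrightarrow> y \<in> X \<Longrightarrow> (\<And>j. \<bar>j - i\<bar> \<le> R1 \<Longrightarrow> x j = y j) \<Longrightarrow> f x i = f y i"
    using curtis_hedlund_lyndon[OF A X f] by blast
  obtain R2 where R2: "0 \<le> R2"
    "\<And>x y i. x \<in> X \<Longrightarrow> y \<in> X \<Longrightarrow> (\<And>j. \<bar>j - i\<bar> \<le> R2 \<Longrightarrow> x j = y j) \<Longrightarrow> g x i = g y i"
    using curtis_hedlund_lyndon[OF A X g] by blast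
  define R where "R = max 1 (max R1 R2)"
  have R: "1 \<le> R" "R1 \<le> R" "R2 \<le> R" by (auto simp: R_def)
  obtain n K where nK: "1 \<le> K" "nat (210 * R) * K \<le> n" "complexity X n < K ^ 2"
    by (rule exists_low_complexity[OF liminf, of "nat (210 * R)"]) (use R in auto)
  have "int (nat (210 * R) * K) \<le> int n" using nK(2) by (simp only: of_nat_le_iff)
  then have n: "210 * R * int K \<le> int n" using R(1) by simp
  \<comment> \<open>The first two entries bound the height of a non-horizontal global period, the
    last one the return time when all rows are periodic.\<close>
  define M where "M = max (max K (fact K)) (card {w. set w \<subseteq> A \<and> length w = K})"
  have *: "\<exists>a b. 0 < a \<and> a \<le> M \<and> (f ^^ a) x = shift_by b x" if x: "x \<in> X" for x
  proof -
    obtain \<eta> :: "int \<Rightarrow> int \<Rightarrow> 'a" where \<eta>: "\<And>n. \<eta> (int n) = (f ^^ n) x" "\<And>s. \<eta> s \<in> X"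
      "\<And>s. \<eta> (s + 1) = f (\<eta> s)" "\<And>s. \<eta> (s - 1) = g (\<eta> s)"
      using shift_aut_orbit[OF X f g gf x] by blast
    have ca: "ca_plane \<eta> R"
    proof (rule ca_plane_shift_aut_orbit[OF X f g R(1) _ _ \<eta>(2-4)])
      fix x y i assume "x \<in> X" "y \<in> X" "\<And>j. \<bar>j - i\<bar> \<le> R \<Longrightarrow> x j = y j"
      then show "f x i = f y i" "g x i = g y i" using R1(2)[of x y i] R2(2)[of x y i] R by auto
    qed
    interpret locally_periodic_plane \<eta> R "int K"
      by (rule locally_periodic_if_low_complexity[OF A X ca \<eta>(2) nK(1) n nK(3)])
    from globally_periodic show ?thesis
    proof (elim disjE exE conjE)
      fix a b assume ab: "0 < a" "a \<le> max (int K) (fact (nat (int K)))" "\<forall>s j. \<eta> (s + a) (j + b) = \<eta> s j"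
      have "\<eta> a = shift_by (- b) (\<eta> 0)"
        using ab(3)[rule_format, of 0 "_ - b"] by (simp add: shift_by_def fun_eq_iff)
      then have "(f ^^ nat a) x = shift_by (- b) x"
        using \<eta>(1)[of "nat a"] \<eta>(1)[of 0] ab(1) by simp
      moreover have "nat a \<le> M"
      proof -
        have "a \<le> int K \<or> a \<le> int (fact K)" using ab(2) by auto
        then have "nat a \<le> K \<or> nat a \<le> fact K" by linarith
        then show ?thesis by (auto simp: M_def)
      qed
      ultimately show ?thesis using ab(1) by (metis zero_less_nat_eq)
    next
      fix b assume b: "b \<noteq> 0" "\<bar>b\<bar> \<le> int K" "\<forall>s j. \<eta> s (j + b) = \<eta> s j"
      have b': "\<eta> s (j + \<bar>b\<bar>) = \<eta> s j" for s j
        using b(3)[rule_format, of s j] b(3)[rule_format, of s "j - b"] by (cases "0 \<le> b") auto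
      let ?W = "{w. set w \<subseteq> A \<and> length w = K}"
      define w where "w t = map (\<lambda>k. \<eta> (int t) (int k)) [0..<K]" for t :: nat
      \<comment> \<open>Rows of period at most \<open>K\<close> are determined by \<open>K\<close>
        consecutive symbols, so two of the rows \<open>0\<close> to \<open>card ?W\<close>
        coincide.\<close>
      have "w ` {..card ?W} \<subseteq> ?W"
        using \<eta>(2) subshift_subset[OF X] unfolding topspace_full_shift w_def by fastforce
      from card_mono[OF finite_lists_length_eq[OF A] this]
      have "card (w ` {..card ?W}) < card {..card ?W}" by simp
      then have "\<not> inj_on w {..card ?W}" by (rule pigeonhole)
      then obtain t1 t2 where t12: "t1 \<le> card ?W" "t2 \<le> card ?W" "t1 \<noteq> t2" "w t1 = w t2"
        unfolding inj_on_def atMost_iff by blast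
      obtain t t' where tt: "t < t'" "t' \<le> card ?W" "w t = w t'"
      proof (cases "t1 < t2")
        case True
        then show ?thesis using that[of t1 t2] t12 by simp
      next
        case False
        then show ?thesis using that[of t2 t1] t12 by simp
      qed
      have same: "\<eta> (int t) = \<eta> (int t')"
      proof (rule eq_if_same_period[of "\<bar>b\<bar>" K])
        show "map (\<lambda>k. \<eta> (int t) (int k)) [0..<K] = map (\<lambda>k. \<eta> (int t') (int k)) [0..<K]"
          using tt(3) by (simp only: w_def)
        show "0 < \<bar>b\<bar>" "\<bar>b\<bar> \<le> int K" using b(1,2) by simp_all
      qed (rule b')+
      \<comment> \<open>The equality of rows \<open>t\<close> and \<open>t'\<close> is a period with
        no horizontal part, and it passes to row \<open>0\<close>, that is, to \<open>x\<close>
        itself.\<close>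
      have "\<eta> 0 j = \<eta> (0 + (int t' - int t)) (j + 0)" for j
        by (rule row_period_global[of "int t"]) (simp add: same)
      then have "(f ^^ (t' - t)) x = shift_by 0 x"
        using \<eta>(1)[of "t' - t"] \<eta>(1)[of 0] tt(1) by (simp add: fun_eq_iff of_nat_diff)
      then show ?thesis
        using tt by (intro exI[of _ "t' - t"] exI[of _ 0]) (simp add: M_def)
    qed
  qed
  show ?thesis
  proof (rule that[of "fact M"])
    fix x assume x: "x \<in> X"
    obtain a b where ab: "0 < a" "a \<le> M" "(f ^^ a) x = shift_by b x" using *[OF x] by blast
    have "a dvd fact M" by (rule dvd_fact) (use ab in auto)
    then obtain m where "fact M = a * m" by (auto elim: dvdE)
    then show "\<exists>b. (f ^^ fact M) x = shift_by b x"
      using funpow_eq_shift_by[OF X f x ab(3)] by metis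
  qed simp
qed

section \<open>Positive words and the resulting relation\<close>

lemma word_value_Aut_shift:
  assumes X: "subshift A X" and g: "g\<^sub>1 \<in> shift_aut A X" "g\<^sub>2 \<in> shift_aut A X"
  shows "word_value (Aut_shift A X) g\<^sub>1 g\<^sub>2 w \<in> shift_aut A X \<and>
    (\<forall>x\<in>X. word_value (Aut_shift A X) g\<^sub>1 g\<^sub>2 w x = foldr (\<lambda>b. if b then g\<^sub>1 else g\<^sub>2) w x)"
proof (induction w)
  case Nil
  interpret G: group "Aut_shift A X" by (rule group_Aut_shift[OF X])
  have "\<one>\<^bsub>Aut_shift A X\<^esub> \<in> shift_aut A X" using G.one_closed by (simp add: Aut_shift_def)
  then show ?case by (simp add: word_value_def) (simp add: Aut_shift_def BijGroup_def)
next
  case (Cons b w)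
  interpret G: group "Aut_shift A X" by (rule group_Aut_shift[OF X])
  let ?g = "if b then g\<^sub>1 else g\<^sub>2" and ?v = "word_value (Aut_shift A X) g\<^sub>1 g\<^sub>2 w"
  have carrier: "carrier (Aut_shift A X) = shift_aut A X" by (simp add: Aut_shift_def)
  have gX: "?g \<in> shift_aut A X" using g by simp
  have v: "word_value (Aut_shift A X) g\<^sub>1 g\<^sub>2 (b # w) = ?g \<otimes>\<^bsub>Aut_shift A X\<^esub> ?v"
    by (simp add: word_value_def)
  also have "\<dots> = compose X ?g ?v"
    using gX Cons shift_aut_subset_Bij[OF X] by (auto simp: Aut_shift_def BijGroup_def subset_iff)
  finally have "word_value (Aut_shift A X) g\<^sub>1 g\<^sub>2 (b # w) = compose X ?g ?v" .
  moreover have "word_value (Aut_shift A X) g\<^sub>1 g\<^sub>2 (b # w) \<in> shift_aut A X"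
    using v G.m_closed[of ?g ?v] gX Cons carrier by simp
  ultimately show ?case using Cons by (simp add: compose_eq)
qed

theorem theorem2:
  fixes A :: "'a set" and X :: "(int \<Rightarrow> 'a) set"
  assumes "finite A"
    and "subshift A X"
    and "liminf (\<lambda>n. ereal (real (complexity X n) / (real n)\<^sup>2)) = 0"
  shows "\<not> contains_free_semigroup2 (Aut_shift A X)"
proof
  note X = assms(2)
  let ?v = "word_value (Aut_shift A X)"
  assume "contains_free_semigroup2 (Aut_shift A X)"
  then obtain f g where fg: "f \<in> shift_aut A X" "g \<in> shift_aut A X" and inj: "inj_on (?v f g) {w. w \<noteq> []}"
    by (auto simp: contains_free_semigroup2_def Aut_shift_def)
  obtain M where M: "0 < M" "\<And>x. x \<in> X \<Longrightarrow> \<exists>b. (f ^^ M) x = shift_by b x"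
    using funpow_eq_shift_by_exists[OF assms(1) X fg(1) assms(3)] by blast
  obtain N where N: "0 < N" "\<And>x. x \<in> X \<Longrightarrow> \<exists>b. (g ^^ N) x = shift_by b x"
    using funpow_eq_shift_by_exists[OF assms(1) X fg(2) assms(3)] by blast
  \<comment> \<open>As \<open>M\<close> and \<open>N\<close> are positive, these words begin with
    different letters.\<close>
  let ?u = "replicate M True @ replicate N False" and ?w = "replicate N False @ replicate M True"
  have "?v f g ?u = ?v f g ?w"
  proof (rule extensionalityI)
    show "?v f g ?u \<in> extensional X" "?v f g ?w \<in> extensional X"
      using word_value_Aut_shift[OF X fg] by (auto simp: shift_aut_def)
    fix x assume x: "x \<in> X"
    obtain b c where bc: "(f ^^ M) x = shift_by b x" "(g ^^ N) x = shift_by c x"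
      using M(2)[OF x] N(2)[OF x] by blast
    \<comment> \<open>Both sides equal \<open>shift_by (b + c) x\<close>: a power of an automorphism
      commutes with shifts, so it is enough to know the shifts \<open>b\<close> and \<open>c\<close>
      at this one point.\<close>
    have "(f ^^ M) ((g ^^ N) x) = (g ^^ N) ((f ^^ M) x)"
      using bc funpow_shift_aut_shift_by[OF X _ x] fg by (simp add: shift_by_add add.commute)
    then show "?v f g ?u x = ?v f g ?w x"
      using word_value_Aut_shift[OF X fg] x by simp
  qed
  then have "?u = ?w" by (rule inj_onD[OF inj]) (use M(1) N(1) in simp_all)
  then have "hd ?u = hd ?w" by (simp only:)
  then show False using M(1) N(1) by (simp add: hd_append)
qed

end
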